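(* Let $\mathbb{K}$ be a topological field, $r,k\in\mathbb{N}_0\cup\{\infty\}$, $M$ and $N$ be $C^{r+k}_{\mathbb{K}}$-manifolds modeled on topological $\mathbb{K}$-vector spaces, and $E$ be a topological $\mathbb{K}$-vector space. Then the following holds: (a) For each map $f\colon M\times N\to E$ of class $C^{r+k}_{\mathbb{K}}$, the associated map $f^\vee\colon M\to C^r(N,E)$, $f^\vee(x):=f(x,\cdot)$, is of class $C^k_{\mathbb{K}}$. (b) The linear map $\Phi\colon C^{r+k}(M\times N,E)\to C^k(M,C^r(N,E))$, $\Phi(f):=f^\vee$, is continuous.
   Context: All topological spaces, fields and topological vector spaces are Hausdorff; topological fields are non-discrete. Differential calculus over a topological field $\mathbb{K}$: For a topological $\mathbb{K}$-vector space $E$ and $U\subseteq E$ open, put $U^{[0]}:=U$, $U^{[1]}:=\{(x,y,t)\in U\times E\times\mathbb{K}: x+ty\in U\}$ and $U^{[j+1]}:=(U^{[j]})^{[1]}$. A map $f\colon U\to F$ into a topological $\mathbb{K}$-vector space is $C^0_{\mathbb{K}}$ if it is continuous ($f^{[0]}:=f$); it is $C^1_{\mathbb{K}}$ if it is continuous and there is a (necessarily unique) continuous map $f^{[1]}\colon U^{[1]}\to F$ with $f^{[1]}(x,y,t)=\frac1t(f(x+ty)-f(x))$ for all $(x,y,t)\in U^{[1]}$ with $t\neq0$; for $k\ge2$ it is $C^k_{\mathbb{K}}$ if it is $C^{k-1}_{\mathbb{K}}$ and $f^{[k-1]}$ is $C^1_{\mathbb{K}}$, and then $f^{[k]}:=(f^{[k-1]})^{[1]}$;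 it is $C^\infty_{\mathbb{K}}$ if it is $C^k_{\mathbb{K}}$ for all $k$. Manifolds modeled on topological vector spaces and $C^k$-maps between them are defined as usual via charts. Function spaces: For $V$ open in a topological $\mathbb{K}$-vector space, $C^r(V,E)$ is the space of $C^r_{\mathbb{K}}$-maps $V\to E$ with the initial topology with respect to the maps $\gamma\mapsto\gamma^{[j]}\in C(V^{[j]},E)$ (compact-open topology), $j\in\mathbb{N}_0$, $j\le r$. For a $C^r_{\mathbb{K}}$-manifold $N$, $C^r(N,E)$ is the space of $C^r_{\mathbb{K}}$-maps $N\to E$ with the initial topology with respect to the maps $\gamma\mapsto\gamma|_U\circ\kappa^{-1}\in C^r(V,E)$, for $\kappa\colon U\to V$ ranging through the charts of $N$. *)

theory Defs
  imports "HOL-Analysis.Analysis" "HOL-Library.Function_Algebras" "HOL-Library.Extended_Nat"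
begin

section \<open>Topological fields and topological vector spaces\<close>

class topological_field = field + t2_space + topological_ab_group_add + topological_semigroup_mult +
  assumes tendsto_inverse_nhds: "a \<noteq> 0 \<Longrightarrow> (inverse \<longlongrightarrow> inverse a) (nhds a)"
    and nondiscrete: "\<exists>S. \<not> open S"

text \<open>
  The vectors are the points of \<open>topspace (topo E)\<close>, which may be a proper subspace of the
  ambient type. This is needed because the function spaces below are topological vector spaces
  whose points form a subspace of a function type. Addition is that of the ambient type.
\<close>

record ('k, 'v) tvs =
  scl :: "'k \<Rightarrow> 'v \<Rightarrow> 'v"
  topo :: "'v topology"

definition tvs :: "('k::topological_field, 'v::ab_group_add) tvs \<Rightarrow> bool" where
  "tvs E \<longleftrightarrow>
     vector_space (scl E) \<and>
     module.subspace (scl E) (topspace (topo E)) \<and>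
     Hausdorff_space (topo E) \<and>
     continuous_map (prod_topology (topo E) (topo E)) (topo E) (\<lambda>(x, y). x + y) \<and>
     continuous_map (prod_topology euclidean (topo E)) (topo E) (\<lambda>(t, x). scl E t x)"

definition prod_tvs :: "('k, 'v) tvs \<Rightarrow> ('k, 'w) tvs \<Rightarrow> ('k, 'v \<times> 'w) tvs" where
  "prod_tvs X Y = \<lparr>scl = (\<lambda>t (x, y). (scl X t x, scl Y t y)), topo = prod_topology (topo X) (topo Y)\<rparr>"


section \<open>Differential calculus\<close>

text \<open>
  The spaces \<open>E\<^sup>[\<^sup>0\<^sup>] = E\<close> and \<open>E\<^sup>[\<^sup>j\<^sup>+\<^sup>1\<^sup>] = E\<^sup>[\<^sup>j\<^sup>] \<times> E\<^sup>[\<^sup>j\<^sup>] \<times> K\<close> have different types for different \<open>j\<close>. To allow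
  recursion on \<open>j\<close>, all of them are realised as subsets of one type: \<open>Ext x y t\<close> stands for the
  triple \<open>(x, y, t)\<close>, and \<open>E\<^sup>[\<^sup>j\<^sup>]\<close> consists of the complete binary trees of height \<open>j\<close>.
\<close>

datatype ('v, 'k) itpoint =
    Base (pt: 'v)
  | Ext (src: "('v, 'k) itpoint") (dir: "('v, 'k) itpoint") (par: 'k)

text \<open>\<open>shift X x t y\<close> is \<open>x + t y\<close> in \<open>X\<^sup>[\<^sup>j\<^sup>]\<close>; it is only used for \<open>x\<close> and \<open>y\<close> of the same height.\<close>

fun shift :: "('k::field, 'v::ab_group_add) tvs \<Rightarrow> ('v, 'k) itpoint \<Rightarrow> 'k \<Rightarrow> ('v, 'k) itpoint
    \<Rightarrow> ('v, 'k) itpoint" where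
  "shift X (Base x) t (Base y) = Base (x + scl X t y)"
| "shift X (Ext x y a) t (Ext x' y' a') = Ext (shift X x t x') (shift X y t y') (a + t * a')"
| "shift X _ t _ = undefined"

primrec it_space :: "('k::topological_field, 'v::ab_group_add) tvs \<Rightarrow> nat \<Rightarrow> ('v, 'k) itpoint topology"
  where
  "it_space X 0 = pullback_topology (range Base) pt (topo X)"
| "it_space X (Suc j) =
     pullback_topology {Ext x y t | x y t. True} (\<lambda>z. (src z, dir z, par z))
       (prod_topology (it_space X j) (prod_topology (it_space X j) euclidean))"

primrec it_set :: "('k::topological_field, 'v::ab_group_add) tvs \<Rightarrow> 'v set \<Rightarrow> nat
    \<Rightarrow> ('v, 'k) itpoint set" where
  "it_set X U 0 = Base ` U"
| "it_set X U (Suc j) =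
     {Ext x y t | x y t. x \<in> it_set X U j \<and> y \<in> topspace (it_space X j) \<and> shift X x t y \<in> it_set X U j}"

definition it_top :: "('k::topological_field, 'v::ab_group_add) tvs \<Rightarrow> 'v set \<Rightarrow> nat
    \<Rightarrow> ('v, 'k) itpoint topology" where
  "it_top X U j = subtopology (it_space X j) (it_set X U j)"

text \<open>\<open>g\<close> is \<open>h\<^sup>[\<^sup>1\<^sup>]\<close> for the function \<open>h\<close> on the open subset \<open>U\<^sup>[\<^sup>j\<^sup>]\<close> of \<open>X\<^sup>[\<^sup>j\<^sup>]\<close>.\<close>

definition is_dq :: "('k::topological_field, 'v::ab_group_add) tvs \<Rightarrow> 'v set
    \<Rightarrow> ('k, 'w::ab_group_add) tvs \<Rightarrow> nat
    \<Rightarrow> (('v, 'k) itpoint \<Rightarrow> 'w) \<Rightarrow> (('v, 'k) itpoint \<Rightarrow> 'w) \<Rightarrow> bool" where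
  "is_dq X U F j h g \<longleftrightarrow>
     continuous_map (it_top X U (Suc j)) (topo F) g \<and>
     (\<forall>x y t. Ext x y t \<in> it_set X U (Suc j) \<longrightarrow> t \<noteq> 0 \<longrightarrow>
        g (Ext x y t) = scl F (1 / t) (h (shift X x t y) - h x))"

text \<open>
  The function \<open>f\<^sup>[\<^sup>j\<^sup>]\<close>. If \<open>f\<close> is of class \<open>C\<^sup>j\<close>, then its values on \<open>U\<^sup>[\<^sup>j\<^sup>]\<close> are uniquely determined,
  as the field is not discrete and \<open>F\<close> is Hausdorff; values elsewhere are arbitrary and irrelevant.
\<close>

primrec iter_dq :: "('k::topological_field, 'v::ab_group_add) tvs \<Rightarrow> 'v set
    \<Rightarrow> ('k, 'w::ab_group_add) tvs \<Rightarrow> ('v \<Rightarrow> 'w) \<Rightarrow> nat \<Rightarrow> ('v, 'k) itpoint \<Rightarrow> 'w" where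
  "iter_dq X U F f 0 = (\<lambda>z. f (pt z))"
| "iter_dq X U F f (Suc j) = (SOME g. is_dq X U F j (iter_dq X U F f j) g)"

primrec C_fin :: "('k::topological_field, 'v::ab_group_add) tvs \<Rightarrow> 'v set
    \<Rightarrow> ('k, 'w::ab_group_add) tvs \<Rightarrow> nat \<Rightarrow> ('v \<Rightarrow> 'w) \<Rightarrow> bool" where
  "C_fin X U F 0 f \<longleftrightarrow> continuous_map (subtopology (topo X) U) (topo F) f"
| "C_fin X U F (Suc j) f \<longleftrightarrow>
     C_fin X U F j f \<and>
     continuous_map (it_top X U j) (topo F) (iter_dq X U F f j) \<and>
     (\<exists>g. is_dq X U F j (iter_dq X U F f j) g)"

definition C_on :: "enat \<Rightarrow> ('k::topological_field, 'v::ab_group_add) tvs \<Rightarrow> 'v set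
    \<Rightarrow> ('k, 'w::ab_group_add) tvs \<Rightarrow> ('v \<Rightarrow> 'w) \<Rightarrow> bool" where
  "C_on r X U F f \<longleftrightarrow> (\<forall>j. enat j \<le> r \<longrightarrow> C_fin X U F j f)"


section \<open>Function spaces on open sets\<close>

text \<open>
  Functions on a set are represented by functions on the ambient type. In \<open>compact_open\<close> the values
  outside \<open>topspace S\<close> are unconstrained; the topology is only used to define initial
  topologies, for which this makes no difference.
\<close>

definition compact_open :: "'a topology \<Rightarrow> 'b topology \<Rightarrow> ('a \<Rightarrow> 'b) topology" where
  "compact_open S T =
     topology_generated_by
       {{f. continuous_map S T f \<and> f ` K \<subseteq> W} | K W. compactin S K \<and> openin T W}"

text \<open>Including \<open>A\<close> itself makes \<open>A\<close> the underlying set even if \<open>I\<close> is empty.\<close>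

definition initial_topology :: "'a set \<Rightarrow> 'i set \<Rightarrow> ('i \<Rightarrow> 'a \<Rightarrow> 'b) \<Rightarrow> ('i \<Rightarrow> 'b topology) \<Rightarrow> 'a topology"
  where
  "initial_topology A I \<phi> T =
     topology_generated_by (insert A {\<phi> i -` W \<inter> A | i W. i \<in> I \<and> openin (T i) W})"

text \<open>Here and for manifolds, a map on a set is represented by its extension by \<open>0\<close>, so that the
  representation is unique and the maps form a subspace of the function type.\<close>

definition C_top :: "enat \<Rightarrow> ('k::topological_field, 'v::ab_group_add) tvs \<Rightarrow> 'v set
    \<Rightarrow> ('k, 'w::ab_group_add) tvs \<Rightarrow> ('v \<Rightarrow> 'w) topology" where
  "C_top r X V F =
     initial_topology {\<gamma>. C_on r X V F \<gamma> \<and> (\<forall>x. x \<notin> V \<longrightarrow> \<gamma> x = 0)} {j. enat j \<le> r}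
       (\<lambda>j \<gamma>. iter_dq X V F \<gamma> j) (\<lambda>j. compact_open (it_top X V j) (topo F))"


section \<open>Manifolds\<close>

text \<open>A chart \<open>\<kappa> : U \<rightarrow> V\<close> is the pair \<open>(U, \<kappa>)\<close>, with \<open>V = \<kappa> ` U\<close>; the values of \<open>\<kappa>\<close> outside \<open>U\<close> are
  irrelevant.\<close>

type_synonym ('m, 'v) chart = "'m set \<times> ('m \<Rightarrow> 'v)"

definition is_chart :: "('k, 'v) tvs \<Rightarrow> 'm topology \<Rightarrow> ('m, 'v) chart \<Rightarrow> bool" where
  "is_chart X T = (\<lambda>(U, \<kappa>).
     openin T U \<and> openin (topo X) (\<kappa> ` U) \<and>
     homeomorphic_map (subtopology T U) (subtopology (topo X) (\<kappa> ` U)) \<kappa>)"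

definition C_transition :: "enat \<Rightarrow> ('k::topological_field, 'v::ab_group_add) tvs
    \<Rightarrow> ('m, 'v) chart \<Rightarrow> ('m, 'v) chart \<Rightarrow> bool" where
  "C_transition l X = (\<lambda>(U, \<kappa>) (U', \<kappa>').
     C_on l X (\<kappa> ` (U \<inter> U')) X (\<kappa>' \<circ> the_inv_into U \<kappa>))"

definition atlas :: "enat \<Rightarrow> ('k::topological_field, 'v::ab_group_add) tvs \<Rightarrow> 'm topology
    \<Rightarrow> ('m, 'v) chart set \<Rightarrow> bool" where
  "atlas l X T A \<longleftrightarrow>
     (\<forall>c\<in>A. is_chart X T c) \<and>
     (\<Union>c\<in>A. fst c) = topspace T \<and>
     (\<forall>c\<in>A. \<forall>d\<in>A. C_transition l X c d)"

definition maximal_atlas :: "enat \<Rightarrow> ('k::topological_field, 'v::ab_group_add) tvs \<Rightarrow> 'm topology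
    \<Rightarrow> ('m, 'v) chart set \<Rightarrow> ('m, 'v) chart set" where
  "maximal_atlas l X T A =
     {c. is_chart X T c \<and> (\<forall>d\<in>A. C_transition l X c d \<and> C_transition l X d c)}"

record ('k, 'm, 'v) mfd =
  model :: "('k, 'v) tvs"
  mtop :: "'m topology"
  charts :: "('m, 'v) chart set"

definition manifold :: "enat \<Rightarrow> ('k::topological_field, 'm, 'v::ab_group_add) mfd \<Rightarrow> bool" where
  "manifold l M \<longleftrightarrow>
     tvs (model M) \<and>
     Hausdorff_space (mtop M) \<and>
     atlas l (model M) (mtop M) (charts M) \<and>
     maximal_atlas l (model M) (mtop M) (charts M) = charts M"

definition prod_mfd :: "enat \<Rightarrow> ('k::topological_field, 'm, 'v::ab_group_add) mfd
    \<Rightarrow> ('k, 'n, 'w::ab_group_add) mfd \<Rightarrow> ('k, 'm \<times> 'n, 'v \<times> 'w) mfd" where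
  "prod_mfd l M N =
     \<lparr>model = prod_tvs (model M) (model N),
      mtop = prod_topology (mtop M) (mtop N),
      charts = maximal_atlas l (prod_tvs (model M) (model N)) (prod_topology (mtop M) (mtop N))
        {(U \<times> V, map_prod \<kappa> \<mu>) | U \<kappa> V \<mu>. (U, \<kappa>) \<in> charts M \<and> (V, \<mu>) \<in> charts N}\<rparr>"

definition chart_rep :: "('m, 'v) chart \<Rightarrow> ('m \<Rightarrow> 'w::zero) \<Rightarrow> 'v \<Rightarrow> 'w" where
  "chart_rep = (\<lambda>(U, \<kappa>) f y. if y \<in> \<kappa> ` U then f (the_inv_into U \<kappa> y) else 0)"

definition C_maps :: "enat \<Rightarrow> ('k::topological_field, 'm, 'v::ab_group_add) mfd
    \<Rightarrow> ('k, 'w::ab_group_add) tvs \<Rightarrow> ('m \<Rightarrow> 'w) set" where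
  "C_maps r M F =
     {f. continuous_map (mtop M) (topo F) f \<and>
         (\<forall>(U, \<kappa>) \<in> charts M. C_on r (model M) (\<kappa> ` U) F (chart_rep (U, \<kappa>) f)) \<and>
         (\<forall>x. x \<notin> topspace (mtop M) \<longrightarrow> f x = 0)}"

definition C_space :: "enat \<Rightarrow> ('k::topological_field, 'm, 'v::ab_group_add) mfd
    \<Rightarrow> ('k, 'w::ab_group_add) tvs \<Rightarrow> ('k, 'm \<Rightarrow> 'w) tvs" where
  "C_space r M F =
     \<lparr>scl = (\<lambda>t f x. scl F t (f x)),
      topo = initial_topology (C_maps r M F) (charts M) chart_rep
        (\<lambda>(U, \<kappa>). C_top r (model M) (\<kappa> ` U) F)\<rparr>"

end

theory Submission
  imports Defs
begin

text \<open>
  The chain rule is avoided by describing all iterated difference quotients explicitly. For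
  \<open>f : M \<times> N \<rightarrow> E\<close>, the \<open>j\<close>-th difference quotient of \<open>f\<^sup>\<or>\<close> at \<open>u\<close> is the function
  \<open>y \<mapsto> (f(\<cdot>, y))\<^sup>[\<^sup>j\<^sup>](u)\<close>, and in charts the \<open>i\<close>-th difference quotient of this function at \<open>w\<close> is
  \<open>f\<^sup>[\<^sup>i\<^sup>+\<^sup>j\<^sup>]\<close> evaluated at a point depending linearly and continuously on \<open>(u, w)\<close>. Since difference
  quotients are unique, it suffices to check the defining relations and continuity of these
  candidates. Both parts then reduce to the exponential law for the compact-open topology, where a
  subbasis of the target is enough because the source spaces are Hausdorff.
\<close>

section \<open>Initial and compact-open topologies\<close>

text \<open>No local compactness is assumed, so evaluation of maps need not be continuous for the
  compact-open topology; only the passage from a jointly continuous map to its curried form is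
  available. For (a) this suffices, since \<open>f\<close> is fixed and the candidates are jointly
  continuous in \<open>u\<close> and \<open>w\<close>. For (b) \<open>f\<close> varies, and joint
  continuity in \<open>f\<close>, \<open>u\<close> and \<open>w\<close> cannot be used. Instead, a
  compact rectangle \<open>K \<times> Q\<close> of pairs \<open>(u, w)\<close> has compact image
  under the fixed continuous map \<open>graft\<close>, and mapping that one compact set into an open
  set is an open condition on the difference quotient of \<open>f\<close> of order
  \<open>i + j\<close>.

  The quotients in the first variable are taken before those in the second. Hence in a tree of
  height \<open>i + j\<close> the outer \<open>i\<close> levels come from \<open>N\<close> and the
  inner \<open>j\<close> levels from \<open>M\<close>. Infinite \<open>r\<close> and
  \<open>k\<close> enter only through finite orders \<open>i \<le> r\<close> and
  \<open>j \<le> k\<close>.\<close>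

lemma topspace_initial_topology [simp]: "topspace (initial_topology A I \<phi> T) = A"
  unfolding initial_topology_def topology_generated_by_topspace by auto

lemma openin_initial_topology_vimage:
  "i \<in> I \<Longrightarrow> openin (T i) W \<Longrightarrow> openin (initial_topology A I \<phi> T) {a \<in> A. \<phi> i a \<in> W}"
  unfolding initial_topology_def
  by (rule topology_generated_by_Basis) (auto simp: vimage_def Int_def)

lemma continuous_map_initial_topology_proj:
  assumes "i \<in> I" "\<And>a. a \<in> A \<Longrightarrow> \<phi> i a \<in> topspace (T i)"
  shows "continuous_map (initial_topology A I \<phi> T) (T i) (\<phi> i)"
  using assms openin_initial_topology_vimage[of i I T _ A \<phi>] by (auto simp: continuous_map_def)

lemma continuous_map_into_initial_topology:
  assumes "\<And>p. p \<in> topspace P \<Longrightarrow> g p \<in> A"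
    and "\<And>i. i \<in> I \<Longrightarrow> continuous_map P (T i) (\<lambda>p. \<phi> i (g p))"
  shows "continuous_map P (initial_topology A I \<phi> T) g"
  unfolding initial_topology_def
proof (rule continuous_on_generated_topo)
  fix W assume "W \<in> insert A {\<phi> i -` W \<inter> A |i W. i \<in> I \<and> openin (T i) W}"
  then consider "W = A" | i V where "i \<in> I" "openin (T i) V" "W = \<phi> i -` V \<inter> A" by blast
  then show "openin P (g -` W \<inter> topspace P)"
  proof cases
    case 1
    then have "g -` W \<inter> topspace P = topspace P" using assms(1) by auto
    then show ?thesis by simp
  next
    case 2
    then have "g -` W \<inter> topspace P = {p \<in> topspace P. \<phi> i (g p) \<in> V}" using assms(1) by auto
    then show ?thesis using openin_continuous_map_preimage[OF assms(2)] 2 by simp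
  qed
qed (use assms(1) in auto)

text \<open>Serves for \<open>it_space X j\<close>, whose topology is a pullback, and for the spaces
  of maps on a manifold, where point evaluations separate.\<close>

lemma Hausdorff_space_separating_maps:
  assumes "\<And>x y. x \<in> topspace S \<Longrightarrow> y \<in> topspace S \<Longrightarrow> x \<noteq> y \<Longrightarrow>
    \<exists>f. continuous_map S T f \<and> f x \<noteq> f y"
    and "Hausdorff_space T"
  shows "Hausdorff_space S"
  unfolding Hausdorff_space_def
proof (intro allI impI)
  fix x y assume *: "x \<in> topspace S \<and> y \<in> topspace S \<and> x \<noteq> y"
  then obtain f where f: "continuous_map S T f" "f x \<noteq> f y" using assms(1) by blast
  then have "f x \<in> topspace T" "f y \<in> topspace T" using * by (auto simp: continuous_map_def)
  then obtain U V where UV: "openin T U" "openin T V" "f x \<in> U" "f y \<in> V" "disjnt U V"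
    using assms(2) f(2) unfolding Hausdorff_space_def by metis
  show "\<exists>U V. openin S U \<and> openin S V \<and> x \<in> U \<and> y \<in> V \<and> disjnt U V"
  proof (intro exI conjI)
    show "openin S {z \<in> topspace S. f z \<in> U}" "openin S {z \<in> topspace S. f z \<in> V}"
      using UV openin_continuous_map_preimage[OF f(1)] by auto
  qed (use UV * in \<open>auto simp: disjnt_iff\<close>)
qed

section \<open>The compact-open topology and its exponential laws\<close>

lemma topspace_compact_open [simp]: "topspace (compact_open S T) = {f. continuous_map S T f}"
proof -
  have "\<exists>K W. {f. continuous_map S T f} = {f. continuous_map S T f \<and> f ` K \<subseteq> W} \<and>
      compactin S K \<and> openin T W"
    by (rule exI[of _ "{}"], rule exI[of _ "{}"]) simp
  then have "{f. continuous_map S T f} \<in>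
      {{f. continuous_map S T f \<and> f ` K \<subseteq> W} |K W. compactin S K \<and> openin T W}"
    by (rule CollectI)
  then show ?thesis
    unfolding compact_open_def topology_generated_by_topspace by blast
qed

lemma openin_compact_open:
  "compactin S K \<Longrightarrow> openin T W \<Longrightarrow> openin (compact_open S T) {f. continuous_map S T f \<and> f ` K \<subseteq> W}"
  unfolding compact_open_def by (rule topology_generated_by_Basis) blast

lemma continuous_map_compact_open_iff:
  "continuous_map P (compact_open S T) \<Phi> \<longleftrightarrow>
     (\<forall>p \<in> topspace P. continuous_map S T (\<Phi> p)) \<and>
     (\<forall>K W. compactin S K \<longrightarrow> openin T W \<longrightarrow> openin P {p \<in> topspace P. \<Phi> p ` K \<subseteq> W})"
  (is "?L \<longleftrightarrow> ?R")
proof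
  assume L: ?L
  have 1: "\<forall>p \<in> topspace P. continuous_map S T (\<Phi> p)"
    using L by (auto simp: continuous_map_def[of P])
  have "openin P {p \<in> topspace P. \<Phi> p ` K \<subseteq> W}" if "compactin S K" "openin T W" for K W
  proof -
    have "{p \<in> topspace P. \<Phi> p ` K \<subseteq> W} =
        {p \<in> topspace P. \<Phi> p \<in> {f. continuous_map S T f \<and> f ` K \<subseteq> W}}"
      using 1 by auto
    then show ?thesis
      using openin_continuous_map_preimage[OF L openin_compact_open[OF that]] by simp
  qed
  with 1 show ?R by blast
next
  assume R: ?R
  show ?L
    unfolding compact_open_def
  proof (rule continuous_on_generated_topo)
    fix X assume "X \<in> {{f. continuous_map S T f \<and> f ` K \<subseteq> W} |K W. compactin S K \<and> openin T W}"
    then obtain K W where KW: "X = {f. continuous_map S T f \<and> f ` K \<subseteq> W}" "compactin S K" "openin T W"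
      by blast
    have "\<Phi> -` X \<inter> topspace P = {p \<in> topspace P. \<Phi> p ` K \<subseteq> W}"
      unfolding KW(1) using conjunct1[OF R] by blast
    then show "openin P (\<Phi> -` X \<inter> topspace P)"
      using conjunct2[OF R, rule_format, OF KW(2,3)] by (rule ssubst)
  next
    have "\<Phi> ` topspace P \<subseteq> topspace (compact_open S T)"
      unfolding topspace_compact_open using conjunct1[OF R] by blast
    then show "\<Phi> ` topspace P \<subseteq> \<Union> {{f. continuous_map S T f \<and> f ` K \<subseteq> W} |K W. compactin S K \<and> openin T W}"
      unfolding compact_open_def topology_generated_by_topspace .
  qed
qed

lemma continuous_map_compact_open_cong:
  assumes "continuous_map P (compact_open S T) \<Psi>"
    and eq: "\<And>p s. p \<in> topspace P \<Longrightarrow> s \<in> topspace S \<Longrightarrow> \<Phi> p s = \<Psi> p s"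
  shows "continuous_map P (compact_open S T) \<Phi>"
  unfolding continuous_map_compact_open_iff
proof (intro conjI ballI allI impI)
  fix p assume p: "p \<in> topspace P"
  then have "continuous_map S T (\<Psi> p)" using assms(1) by (simp add: continuous_map_compact_open_iff)
  then show "continuous_map S T (\<Phi> p)" by (rule continuous_map_eq) (simp add: eq p)
next
  fix K W assume KW: "compactin S K" "openin T W"
  have "K \<subseteq> topspace S" by (rule compactin_subset_topspace[OF KW(1)])
  then have "{p \<in> topspace P. \<Phi> p ` K \<subseteq> W} = {p \<in> topspace P. \<Psi> p ` K \<subseteq> W}"
    using eq by (fastforce simp: image_subset_iff)
  then show "openin P {p \<in> topspace P. \<Phi> p ` K \<subseteq> W}"
    using assms(1) KW by (simp add: continuous_map_compact_open_iff)
qed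

text \<open>The half of the exponential law that needs no local compactness: if
  \<open>{p} \<times> K\<close> lies in the open preimage of \<open>W\<close>, the tube lemma
  enlarges \<open>{p}\<close> to a neighbourhood.\<close>

lemma continuous_map_compact_open_uncurried:
  assumes G: "continuous_map (prod_topology P S) T (\<lambda>(p, s). G p s)"
  shows "continuous_map P (compact_open S T) G"
  unfolding continuous_map_compact_open_iff
proof (intro conjI ballI allI impI)
  fix p assume p: "p \<in> topspace P"
  have "continuous_map S (prod_topology P S) (\<lambda>s. (p, s))"
    using p by (intro continuous_intros) auto
  from continuous_map_compose[OF this G] show "continuous_map S T (G p)"
    by (simp add: o_def)
next
  fix K W assume KW: "compactin S K" "openin T W"
  let ?Z = "{z \<in> topspace (prod_topology P S). (case z of (p, s) \<Rightarrow> G p s) \<in> W}"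
  have Z: "openin (prod_topology P S) ?Z"
    by (rule openin_continuous_map_preimage[OF G KW(2)])
  show "openin P {p \<in> topspace P. G p ` K \<subseteq> W}"
  proof (rule iffD2[OF openin_subopen], rule ballI)
    fix p assume p: "p \<in> {p \<in> topspace P. G p ` K \<subseteq> W}"
    then have "p \<in> topspace P" "{p} \<times> K \<subseteq> ?Z"
      using compactin_subset_topspace[OF KW(1)] by auto
    from tube_lemma_right[OF Z KW(1) this] obtain U V where
      UV: "openin P U" "openin S V" "p \<in> U" "K \<subseteq> V" "U \<times> V \<subseteq> ?Z" by blast
    have "U \<subseteq> {p \<in> topspace P. G p ` K \<subseteq> W}"
    proof
      fix q assume q: "q \<in> U"
      have "G q s \<in> W" if "s \<in> K" for s
      proof -
        have "(q, s) \<in> ?Z" using UV(4,5) q that by blast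
        then show ?thesis by simp
      qed
      then have "G q ` K \<subseteq> W" by (rule image_subsetI)
      then show "q \<in> {p \<in> topspace P. G p ` K \<subseteq> W}" using q openin_subset[OF UV(1)] by auto
    qed
    with UV(1,3) show "\<exists>T. openin P T \<and> p \<in> T \<and> T \<subseteq> {p \<in> topspace P. G p ` K \<subseteq> W}"
      by blast
  qed
qed

text \<open>A compact subset of a Hausdorff space is regular as a subspace, so \<open>x\<close> has
  a closed neighbourhood in \<open>K\<close> inside the preimage of \<open>W\<close>, and a closed
  subset of \<open>K\<close> is compact. This is where the Hausdorff property of the source
  enters.\<close>

lemma compactin_shrink:
  assumes "Hausdorff_space S" "compactin S K" "continuous_map S T f" "openin T W" "x \<in> K" "f x \<in> W"
  shows "\<exists>U L. openin S U \<and> x \<in> U \<and> compactin S L \<and> K \<inter> U \<subseteq> L \<and> f ` L \<subseteq> W"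
proof -
  let ?K = "subtopology S K"
  have "compact_space ?K" using assms(2) by (simp add: compactin_subspace)
  then have reg: "regular_space ?K"
    using assms(1) by (intro compact_Hausdorff_imp_regular_space) (auto intro: Hausdorff_space_subtopology)
  have sub: "K \<subseteq> topspace S" by (rule compactin_subset_topspace[OF assms(2)])
  let ?W = "{y \<in> topspace ?K. f y \<in> W}"
  have "openin ?K ?W"
    using continuous_map_from_subtopology[OF assms(3)] assms(4) by (rule openin_continuous_map_preimage)
  moreover have "x \<in> ?W" using assms(5,6) sub by auto
  ultimately obtain U L where UL: "openin ?K U" "closedin ?K L" "x \<in> U" "U \<subseteq> L" "L \<subseteq> ?W"
    using reg unfolding neighbourhood_base_of_closedin[symmetric] neighbourhood_base_of by meson
  obtain U' where "openin S U'" "U = U' \<inter> K" using UL(1) by (auto simp: openin_subtopology)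
  moreover have "compactin ?K L" using \<open>compact_space ?K\<close> UL(2) by (rule closedin_compact_space)
  then have "compactin S L" by (simp add: compactin_subtopology)
  ultimately show ?thesis using UL by (intro exI[of _ U'] exI[of _ L]) auto
qed

text \<open>Induction on the generation of \<open>W\<close> from the subbasis. Only unions are
  difficult: \<open>K\<close> may be mapped into a union without being mapped into any single
  member, so it is cut into finitely many pieces, each inside a compact set that
  \<open>\<Phi> p\<close> maps into one member. This is why the induction must be general in
  \<open>K\<close>.\<close>

lemma openin_compact_open_generate:
  assumes S: "Hausdorff_space S"
    and cont: "\<And>p. p \<in> topspace P \<Longrightarrow> continuous_map S (topology_generated_by \<B>) (\<Phi> p)"
    and basis: "\<And>K B. compactin S K \<Longrightarrow> B \<in> \<B> \<Longrightarrow> openin P {p \<in> topspace P. \<Phi> p ` K \<subseteq> B}"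
    and W: "generate_topology_on \<B> W" and K: "compactin S K"
  shows "openin P {p \<in> topspace P. \<Phi> p ` K \<subseteq> W}"
  using W K
proof (induction arbitrary: K)
  case Empty
  show ?case by (cases "K = {}") auto
next
  case (Int a b)
  have "{p \<in> topspace P. \<Phi> p ` K \<subseteq> a \<inter> b} =
      {p \<in> topspace P. \<Phi> p ` K \<subseteq> a} \<inter> {p \<in> topspace P. \<Phi> p ` K \<subseteq> b}" by auto
  then show ?case using Int by auto
next
  case (Basis s)
  then show ?case by (auto intro: basis)
next
  case (UN \<W>)
  let ?O = "{p \<in> topspace P. \<Phi> p ` K \<subseteq> \<Union>\<W>}"
  show ?case
  proof (rule iffD2[OF openin_subopen], rule ballI)
    fix p assume p: "p \<in> ?O"
    \<comment> \<open>\<open>\<U>\<close> consists of the open sets whose trace on \<open>K\<close>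
      lies in a compact \<open>L\<close> that \<open>\<Phi> p\<close> sends into a single member of
      \<open>\<W>\<close>; the induction hypothesis applies to such pairs of \<open>L\<close> and
      \<open>W\<close>.\<close>
    define \<U> where "\<U> = {U. openin S U \<and> (\<exists>L W. compactin S L \<and> K \<inter> U \<subseteq> L \<and> \<Phi> p ` L \<subseteq> W \<and> W \<in> \<W>)}"
    have "\<exists>\<F>. finite \<F> \<and> \<F> \<subseteq> \<U> \<and> K \<subseteq> \<Union>\<F>"
    proof (rule compactinD[OF UN.prems])
      show "K \<subseteq> \<Union>\<U>"
      proof
        fix x assume "x \<in> K"
        obtain W where W: "W \<in> \<W>" "\<Phi> p x \<in> W" using p \<open>x \<in> K\<close> by blast
        have "openin (topology_generated_by \<B>) W"
          using UN(1)[OF W(1)] by (simp add: openin_topology_generated_by_iff)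
        moreover have "p \<in> topspace P" using p by blast
        ultimately obtain U L where "openin S U \<and> x \<in> U \<and> compactin S L \<and> K \<inter> U \<subseteq> L \<and> \<Phi> p ` L \<subseteq> W"
          using compactin_shrink[OF S UN.prems cont _ \<open>x \<in> K\<close> W(2)] by blast
        then show "x \<in> \<Union>\<U>" using W(1) unfolding \<U>_def by blast
      qed
    qed (simp add: \<U>_def)
    then obtain \<F> where \<F>: "finite \<F>" "\<F> \<subseteq> \<U>" "K \<subseteq> \<Union>\<F>" by blast
    have "\<forall>U\<in>\<F>. \<exists>T. openin P T \<and> p \<in> T \<and> (\<forall>q\<in>T. \<Phi> q ` (K \<inter> U) \<subseteq> \<Union>\<W>)"
    proof
      fix U assume "U \<in> \<F>"
      then obtain L W where LW: "compactin S L" "K \<inter> U \<subseteq> L" "\<Phi> p ` L \<subseteq> W" "W \<in> \<W>"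
        using \<F>(2) unfolding \<U>_def by blast
      show "\<exists>T. openin P T \<and> p \<in> T \<and> (\<forall>q\<in>T. \<Phi> q ` (K \<inter> U) \<subseteq> \<Union>\<W>)"
      proof (intro exI conjI)
        show "openin P {q \<in> topspace P. \<Phi> q ` L \<subseteq> W}" by (rule UN.IH[OF LW(4,1)])
      qed (use LW p in blast)+
    qed
    from bchoice[OF this] obtain T where
      T: "\<forall>U\<in>\<F>. openin P (T U) \<and> p \<in> T U \<and> (\<forall>q\<in>T U. \<Phi> q ` (K \<inter> U) \<subseteq> \<Union>\<W>)" ..
    \<comment> \<open>Intersecting with \<open>topspace P\<close> covers the case of an empty
      \<open>\<F>\<close>, where the intersection of the family is the whole type.\<close>
    have "openin P (topspace P \<inter> \<Inter>(T ` \<F>))"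
      using \<F>(1) T by (intro openin_Int_Inter) auto
    moreover have "p \<in> topspace P \<inter> \<Inter>(T ` \<F>)" using p T by blast
    moreover have "topspace P \<inter> \<Inter>(T ` \<F>) \<subseteq> ?O"
    proof
      fix q assume q: "q \<in> topspace P \<inter> \<Inter>(T ` \<F>)"
      have "\<Phi> q x \<in> \<Union>\<W>" if "x \<in> K" for x
      proof -
        obtain U where U: "U \<in> \<F>" "x \<in> U" using \<F>(3) \<open>x \<in> K\<close> by blast
        have "q \<in> T U" using q U(1) by blast
        moreover have "\<forall>q\<in>T U. \<Phi> q ` (K \<inter> U) \<subseteq> \<Union>\<W>" using bspec[OF T U(1)] by (elim conjE)
        ultimately have "\<Phi> q ` (K \<inter> U) \<subseteq> \<Union>\<W>" by blast
        moreover have "\<Phi> q x \<in> \<Phi> q ` (K \<inter> U)" using U(2) \<open>x \<in> K\<close> by (intro imageI IntI)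
        ultimately show ?thesis by (rule subsetD)
      qed
      then have "\<Phi> q ` K \<subseteq> \<Union>\<W>" by (rule image_subsetI)
      then show "q \<in> ?O" using q by simp
    qed
    ultimately show "\<exists>T. openin P T \<and> p \<in> T \<and> T \<subseteq> ?O" by (intro exI conjI)
  qed
qed

text \<open>For a Hausdorff source, passing to spaces of continuous maps preserves initial
  topologies: the preimages under the \<open>\<phi> i\<close> form a subbasis of the target, and a
  subbasis suffices.\<close>

lemma continuous_map_compact_open_initial_topology:
  assumes S: "Hausdorff_space S"
    and A: "\<And>p s. p \<in> topspace P \<Longrightarrow> s \<in> topspace S \<Longrightarrow> \<Phi> p s \<in> A"
    and \<phi>: "\<And>i. i \<in> I \<Longrightarrow> continuous_map P (compact_open S (T i)) (\<lambda>p s. \<phi> i (\<Phi> p s))"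
  shows "continuous_map P (compact_open S (initial_topology A I \<phi> T)) \<Phi>"
proof -
  have cont: "continuous_map S (initial_topology A I \<phi> T) (\<Phi> p)" if "p \<in> topspace P" for p
  proof (rule continuous_map_into_initial_topology)
    fix i assume "i \<in> I"
    from \<phi>[OF this] show "continuous_map S (T i) (\<lambda>s. \<phi> i (\<Phi> p s))"
      using that unfolding continuous_map_compact_open_iff by blast
  qed (rule A[OF that])
  have basis: "openin P {p \<in> topspace P. \<Phi> p ` K \<subseteq> B}"
    if K: "compactin S K" and B: "B \<in> insert A {\<phi> i -` W \<inter> A |i W. i \<in> I \<and> openin (T i) W}" for K B
  proof -
    have KS: "K \<subseteq> topspace S" by (rule compactin_subset_topspace[OF K])
    from B consider "B = A" | i V where "i \<in> I" "openin (T i) V" "B = \<phi> i -` V \<inter> A" by blast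
    then show ?thesis
    proof cases
      case 1
      then have "{p \<in> topspace P. \<Phi> p ` K \<subseteq> B} = topspace P" using A KS by auto
      then show ?thesis by simp
    next
      case 2
      then have "{p \<in> topspace P. \<Phi> p ` K \<subseteq> B} = {p \<in> topspace P. (\<lambda>s. \<phi> i (\<Phi> p s)) ` K \<subseteq> V}"
        using A KS by (auto simp: image_subset_iff)
      moreover have "openin P {p \<in> topspace P. (\<lambda>s. \<phi> i (\<Phi> p s)) ` K \<subseteq> V}"
        using \<phi>[OF 2(1)] 2(2) K unfolding continuous_map_compact_open_iff by blast
      ultimately show ?thesis by simp
    qed
  qed
  show ?thesis
    unfolding continuous_map_compact_open_iff
  proof (intro conjI allI ballI impI)
    fix K W assume K: "compactin S K" and W: "openin (initial_topology A I \<phi> T) W"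
    show "openin P {p \<in> topspace P. \<Phi> p ` K \<subseteq> W}"
      by (rule openin_compact_open_generate[OF S cont[unfolded initial_topology_def] basis
            W[unfolded initial_topology_def openin_topology_generated_by_iff] K])
  qed (rule cont)
qed

text \<open>Testing the inner compact-open topology on its subbasis turns a condition on
  \<open>K\<close> with values in a function space into a condition on the compact rectangle
  \<open>K \<times> Q\<close>. Joint continuity \<open>G\<close> is required for each
  \<open>p\<close> separately and not in \<open>p\<close>, which is the form available when
  \<open>p\<close> is itself a function.\<close>

lemma continuous_map_compact_open_compact_open:
  assumes S: "Hausdorff_space S"
    and G: "\<And>p. p \<in> topspace P \<Longrightarrow> continuous_map (prod_topology S L) T (\<lambda>(s, l). \<Phi> p s l)"
    and op: "\<And>K Q W. compactin S K \<Longrightarrow> compactin L Q \<Longrightarrow> openin T W \<Longrightarrow>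
      openin P {p \<in> topspace P. \<forall>s\<in>K. \<forall>l\<in>Q. \<Phi> p s l \<in> W}"
  shows "continuous_map P (compact_open S (compact_open L T)) \<Phi>"
proof -
  have cont: "continuous_map S (compact_open L T) (\<Phi> p)" if "p \<in> topspace P" for p
    using G[OF that] by (rule continuous_map_compact_open_uncurried)
  have contL: "continuous_map L T (\<Phi> p s)" if "p \<in> topspace P" "s \<in> topspace S" for p s
    using continuous_map_funspace[OF cont[OF that(1)]] that(2) by auto
  have basis: "openin P {p \<in> topspace P. \<Phi> p ` K \<subseteq> B}"
    if K: "compactin S K" and B: "B \<in> {{f. continuous_map L T f \<and> f ` Q \<subseteq> W} |Q W. compactin L Q \<and> openin T W}"
    for K B
  proof -
    have KS: "K \<subseteq> topspace S" by (rule compactin_subset_topspace[OF K])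
    from B obtain Q W where QW: "compactin L Q" "openin T W" "B = {f. continuous_map L T f \<and> f ` Q \<subseteq> W}"
      by blast
    have "{p \<in> topspace P. \<Phi> p ` K \<subseteq> B} = {p \<in> topspace P. \<forall>s\<in>K. \<forall>l\<in>Q. \<Phi> p s l \<in> W}"
      unfolding QW(3) using contL KS by (auto simp: image_subset_iff)
    then show ?thesis using op[OF K QW(1,2)] by simp
  qed
  show ?thesis
    unfolding continuous_map_compact_open_iff[of P S]
  proof (intro conjI allI ballI impI)
    fix K W assume K: "compactin S K" and W: "openin (compact_open L T) W"
    show "openin P {p \<in> topspace P. \<Phi> p ` K \<subseteq> W}"
      by (rule openin_compact_open_generate[OF S cont[unfolded compact_open_def] basis
            W[unfolded compact_open_def openin_topology_generated_by_iff] K])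
  qed (rule cont)
qed


section \<open>The iterated tangent spaces\<close>

lemma tvs_scl:
  assumes "tvs E"
  shows tvs_scl_zero_right: "scl E t 0 = 0"
    and tvs_scl_zero_left: "scl E 0 x = 0"
    and tvs_scl_one: "scl E 1 x = x"
    and tvs_scl_add_right: "scl E t (x + y) = scl E t x + scl E t y"
    and tvs_scl_add_left: "scl E (s + t) x = scl E s x + scl E t x"
    and tvs_scl_scl: "scl E s (scl E t x) = scl E (s * t) x"
proof -
  interpret vector_space "scl E" using assms by (simp add: tvs_def)
  show "scl E t 0 = 0" "scl E 0 x = 0" "scl E 1 x = x" "scl E t (x + y) = scl E t x + scl E t y"
    "scl E (s + t) x = scl E s x + scl E t x" "scl E s (scl E t x) = scl E (s * t) x"
    by (simp_all add: scale_right_distrib scale_left_distrib)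
qed

lemma tvs_topspace:
  assumes "tvs E"
  shows tvs_zero_in: "0 \<in> topspace (topo E)"
    and tvs_add_in: "x \<in> topspace (topo E) \<Longrightarrow> y \<in> topspace (topo E) \<Longrightarrow> x + y \<in> topspace (topo E)"
    and tvs_scl_in: "x \<in> topspace (topo E) \<Longrightarrow> scl E t x \<in> topspace (topo E)"
proof -
  interpret vector_space "scl E" using assms by (simp add: tvs_def)
  have "subspace (topspace (topo E))" using assms by (simp add: tvs_def)
  then show "0 \<in> topspace (topo E)"
    "x \<in> topspace (topo E) \<Longrightarrow> y \<in> topspace (topo E) \<Longrightarrow> x + y \<in> topspace (topo E)"
    "x \<in> topspace (topo E) \<Longrightarrow> scl E t x \<in> topspace (topo E)"
    by (simp_all add: subspace_def)
qed

lemma tvs_Hausdorff: "tvs E \<Longrightarrow> Hausdorff_space (topo E)"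
  by (simp add: tvs_def)

lemma tvs_continuous_add:
  assumes "tvs E" "continuous_map Z (topo E) f" "continuous_map Z (topo E) g"
  shows "continuous_map Z (topo E) (\<lambda>z. f z + g z)"
proof -
  have "continuous_map (prod_topology (topo E) (topo E)) (topo E) (\<lambda>(x, y). x + y)"
    using assms(1) by (simp add: tvs_def)
  from continuous_map_compose[OF continuous_map_pairedI[OF assms(2,3)] this]
  show ?thesis by (simp add: o_def)
qed

lemma tvs_continuous_scl:
  assumes "tvs E" "continuous_map Z euclidean c" "continuous_map Z (topo E) g"
  shows "continuous_map Z (topo E) (\<lambda>z. scl E (c z) (g z))"
proof -
  have "continuous_map (prod_topology euclidean (topo E)) (topo E) (\<lambda>(t, x). scl E t x)"
    using assms(1) by (simp add: tvs_def)
  from continuous_map_compose[OF continuous_map_pairedI[OF assms(2,3)] this]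
  show ?thesis by (simp add: o_def)
qed

lemma continuous_map_field_add_mult:
  fixes a b c :: "'z \<Rightarrow> 'k::topological_field"
  assumes "continuous_map Z euclidean a" "continuous_map Z euclidean b" "continuous_map Z euclidean c"
  shows "continuous_map Z euclidean (\<lambda>z. a z + b z * c z)"
proof -
  have "continuous_map (prod_topology euclidean (prod_topology euclidean euclidean)) euclidean
      (\<lambda>(x, y, z :: 'k). x + y * z)"
    by (simp add: case_prod_beta) (intro continuous_intros)
  from continuous_map_compose[OF continuous_map_pairedI[OF assms(1) continuous_map_pairedI[OF assms(2,3)]] this]
  show ?thesis by (simp add: o_def)
qed

lemma not_open_singleton_field: "\<not> open {a :: 'k::topological_field}"
proof
  assume "open {a}"
  have "open {b :: 'k}" for b
  proof -
    have "continuous_on UNIV (\<lambda>x. x + (a - b))" by (intro continuous_intros)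
    then have "open ((\<lambda>x. x + (a - b)) -` {a})"
      using \<open>open {a}\<close> by (simp add: continuous_on_open_vimage)
    moreover have "(\<lambda>x. x + (a - b)) -` {a} = {b}" by (auto simp: algebra_simps)
    ultimately show ?thesis by simp
  qed
  then have "open S" for S :: "'k set"
    using open_UN[of S "\<lambda>x. {x}"] by simp
  then show False using nondiscrete by blast
qed

section \<open>Topology and linear structure on trees\<close>

lemma mem_topspace_it_space [simp]:
  "Base v \<in> topspace (it_space X 0) \<longleftrightarrow> v \<in> topspace (topo X)"
  "Ext x y t \<notin> topspace (it_space X 0)"
  "Base v \<notin> topspace (it_space X (Suc j))"
  "Ext x y t \<in> topspace (it_space X (Suc j)) \<longleftrightarrow> x \<in> topspace (it_space X j) \<and> y \<in> topspace (it_space X j)"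
  by (auto simp: topspace_pullback_topology)

lemma topspace_it_space_0E:
  assumes "z \<in> topspace (it_space X 0)"
  obtains x where "z = Base x" "x \<in> topspace (topo X)"
  using assms by (cases z) (auto simp del: it_space.simps)

lemma topspace_it_space_SucE:
  assumes "z \<in> topspace (it_space X (Suc j))"
  obtains x y t where "z = Ext x y t" "x \<in> topspace (it_space X j)" "y \<in> topspace (it_space X j)"
  using assms by (cases z) (auto simp del: it_space.simps)

lemma continuous_map_Base:
  assumes "continuous_map Z (topo X) g"
  shows "continuous_map Z (it_space X 0) (\<lambda>z. Base (g z))"
  using assms by (auto intro!: continuous_map_pullback' simp: o_def)

lemma continuous_map_Ext:
  assumes "continuous_map Z (it_space X j) a" "continuous_map Z (it_space X j) b" "continuous_map Z euclidean c"
  shows "continuous_map Z (it_space X (Suc j)) (\<lambda>z. Ext (a z) (b z) (c z))"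
  using assms by (auto intro!: continuous_map_pullback' continuous_map_pairedI simp: o_def)

lemma continuous_map_pt:
  assumes "continuous_map Z (it_space X 0) f"
  shows "continuous_map Z (topo X) (\<lambda>z. pt (f z))"
proof -
  have "continuous_map (it_space X 0) (topo X) (id \<circ> pt)"
    unfolding it_space.simps by (rule continuous_map_pullback) simp
  from continuous_map_compose[OF assms this] show ?thesis by (simp add: o_def)
qed

lemma
  assumes "continuous_map Z (it_space X (Suc j)) f"
  shows continuous_map_src: "continuous_map Z (it_space X j) (\<lambda>z. src (f z))"
    and continuous_map_dir: "continuous_map Z (it_space X j) (\<lambda>z. dir (f z))"
    and continuous_map_par: "continuous_map Z euclidean (\<lambda>z. par (f z))"
proof -
  let ?P = "prod_topology (it_space X j) (prod_topology (it_space X j) euclidean)"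
  have "continuous_map (it_space X (Suc j)) ?P (id \<circ> (\<lambda>z. (src z, dir z, par z)))"
    unfolding it_space.simps by (rule continuous_map_pullback) simp
  from continuous_map_compose[OF assms this] have *: "continuous_map Z ?P (\<lambda>z. (src (f z), dir (f z), par (f z)))"
    by (simp add: o_def)
  show "continuous_map Z (it_space X j) (\<lambda>z. src (f z))"
    using continuous_map_compose[OF * continuous_map_fst] by (simp add: o_def)
  have **: "continuous_map Z (prod_topology (it_space X j) euclidean) (\<lambda>z. (dir (f z), par (f z)))"
    using continuous_map_compose[OF * continuous_map_snd] by (simp add: o_def)
  show "continuous_map Z (it_space X j) (\<lambda>z. dir (f z))"
    using continuous_map_compose[OF ** continuous_map_fst] by (simp add: o_def)
  show "continuous_map Z euclidean (\<lambda>z. par (f z))"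
    using continuous_map_compose[OF ** continuous_map_snd] by (simp add: o_def)
qed

lemma continuous_map_it_space_mem: "continuous_map Z T f \<Longrightarrow> z \<in> topspace Z \<Longrightarrow> f z \<in> topspace T"
  by (auto simp: continuous_map_def)

text \<open>Written with the selectors, the shift is built from maps known to be continuous.
  \<open>shift\<close> itself is \<open>undefined\<close> on trees of different shape, so the two
  expressions are compared only at points of \<open>topspace Z\<close>, where the shapes are known.
  The later continuity proofs for recursive functions on trees follow the same pattern.\<close>

lemma continuous_map_shift:
  assumes X: "tvs X"
    and "continuous_map Z (it_space X j) f" "continuous_map Z euclidean c" "continuous_map Z (it_space X j) g"
  shows "continuous_map Z (it_space X j) (\<lambda>z. shift X (f z) (c z) (g z))"
  using assms(2-)
proof (induction j arbitrary: f g)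
  case 0
  have "continuous_map Z (it_space X 0) (\<lambda>z. Base (pt (f z) + scl X (c z) (pt (g z))))"
    by (intro continuous_map_Base tvs_continuous_add[OF X] tvs_continuous_scl[OF X] continuous_map_pt 0)
  then show ?case
  proof (rule continuous_map_eq)
    fix z assume z: "z \<in> topspace Z"
    show "Base (pt (f z) + scl X (c z) (pt (g z))) = shift X (f z) (c z) (g z)"
      using topspace_it_space_0E[OF continuous_map_it_space_mem[OF 0(1) z]]
        topspace_it_space_0E[OF continuous_map_it_space_mem[OF 0(3) z]] by (metis itpoint.sel(1) shift.simps(1))
  qed
next
  case (Suc j)
  have "continuous_map Z (it_space X (Suc j)) (\<lambda>z. Ext (shift X (src (f z)) (c z) (src (g z)))
      (shift X (dir (f z)) (c z) (dir (g z))) (par (f z) + c z * par (g z)))"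
    by (intro continuous_map_Ext Suc.IH continuous_map_field_add_mult continuous_map_src
        continuous_map_dir continuous_map_par[OF Suc.prems(1)] continuous_map_par[OF Suc.prems(3)] Suc.prems)
  then show ?case
  proof (rule continuous_map_eq)
    fix z assume z: "z \<in> topspace Z"
    show "Ext (shift X (src (f z)) (c z) (src (g z)))
      (shift X (dir (f z)) (c z) (dir (g z))) (par (f z) + c z * par (g z)) = shift X (f z) (c z) (g z)"
      using topspace_it_space_SucE[OF continuous_map_it_space_mem[OF Suc.prems(1) z]]
        topspace_it_space_SucE[OF continuous_map_it_space_mem[OF Suc.prems(3) z]]
      by (metis itpoint.sel(2-4) shift.simps(2))
  qed
qed

lemma shift_in_it_space:
  assumes "tvs X" "x \<in> topspace (it_space X j)" "y \<in> topspace (it_space X j)"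
  shows "shift X x t y \<in> topspace (it_space X j)"
  using assms(2,3)
proof (induction j arbitrary: x y)
  case 0
  then show ?case
    by (auto elim!: topspace_it_space_0E simp del: it_space.simps simp: tvs_add_in tvs_scl_in assms(1))
next
  case (Suc j)
  then show ?case by (auto elim!: topspace_it_space_SucE simp del: it_space.simps)
qed

lemma mem_it_set [simp]:
  "Base v \<in> it_set X U 0 \<longleftrightarrow> v \<in> U"
  "Ext x y t \<notin> it_set X U 0"
  "Base v \<notin> it_set X U (Suc j)"
  "Ext x y t \<in> it_set X U (Suc j) \<longleftrightarrow>
     x \<in> it_set X U j \<and> y \<in> topspace (it_space X j) \<and> shift X x t y \<in> it_set X U j"
  by auto

declare it_set.simps [simp del] it_space.simps [simp del]

lemma it_set_0E:
  assumes "z \<in> it_set X U 0"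
  obtains x where "z = Base x" "x \<in> U"
  using assms by (cases z) auto

lemma it_set_SucE:
  assumes "z \<in> it_set X U (Suc j)"
  obtains x y t where "z = Ext x y t" "x \<in> it_set X U j" "y \<in> topspace (it_space X j)"
    "shift X x t y \<in> it_set X U j"
  using assms by (cases z) auto

text \<open>The whole space is closed under \<open>shift\<close>. Together with monotonicity in
  \<open>U\<close> this places every \<open>it_set X U j\<close> inside
  \<open>topspace (it_space X j)\<close>.\<close>

lemma it_set_topspace:
  assumes "tvs X"
  shows "it_set X (topspace (topo X)) j = topspace (it_space X j)"
proof (induction j)
  case 0
  show ?case by (auto elim!: it_set_0E topspace_it_space_0E)
next
  case (Suc j)
  show ?case
    by (auto elim!: it_set_SucE topspace_it_space_SucE simp: Suc.IH shift_in_it_space[OF assms])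
qed

lemma it_set_mono: "U \<subseteq> V \<Longrightarrow> it_set X U j \<subseteq> it_set X V j"
  by (induction j) (auto elim!: it_set_0E it_set_SucE)

lemma it_set_subset: "tvs X \<Longrightarrow> U \<subseteq> topspace (topo X) \<Longrightarrow> it_set X U j \<subseteq> topspace (it_space X j)"
  using it_set_mono it_set_topspace by metis

lemma openin_it_set:
  assumes X: "tvs X" and U: "openin (topo X) U"
  shows "openin (it_space X j) (it_set X U j)"
proof (induction j)
  case 0
  have "openin (it_space X 0) {z \<in> topspace (it_space X 0). pt z \<in> U}"
    using continuous_map_pt[OF continuous_map_id] U by (intro openin_continuous_map_preimage) (auto simp: id_def)
  also have "{z \<in> topspace (it_space X 0). pt z \<in> U} = it_set X U 0"
    using openin_subset[OF U] by (auto elim!: it_set_0E topspace_it_space_0E)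
  finally show ?case .
next
  case (Suc j)
  let ?S = "it_space X (Suc j)"
  have id: "continuous_map ?S ?S (\<lambda>z. z)" by simp
  have "openin ?S {z \<in> topspace ?S. src z \<in> it_set X U j}"
    by (rule openin_continuous_map_preimage[OF continuous_map_src[OF id] Suc.IH])
  moreover have "openin ?S {z \<in> topspace ?S. shift X (src z) (par z) (dir z) \<in> it_set X U j}"
    by (rule openin_continuous_map_preimage[OF continuous_map_shift[OF X continuous_map_src[OF id]
            continuous_map_par[OF id] continuous_map_dir[OF id]] Suc.IH])
  ultimately have "openin ?S ({z \<in> topspace ?S. src z \<in> it_set X U j} \<inter>
      {z \<in> topspace ?S. shift X (src z) (par z) (dir z) \<in> it_set X U j})" by (rule openin_Int)
  also have "\<dots> = it_set X U (Suc j)"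
    using openin_subset[OF Suc.IH] by (auto elim!: it_set_SucE topspace_it_space_SucE)
  finally show ?case .
qed

lemma topspace_it_top [simp]: "tvs X \<Longrightarrow> openin (topo X) U \<Longrightarrow> topspace (it_top X U j) = it_set X U j"
  using openin_subset[OF openin_it_set] by (auto simp: it_top_def)

lemma Hausdorff_space_euclidean_t2: "Hausdorff_space (euclidean :: 'a::t2_space topology)"
  unfolding Hausdorff_space_def disjnt_def using hausdorff by auto

lemma Hausdorff_it_space:
  assumes "Hausdorff_space (topo X)"
  shows "Hausdorff_space (it_space X j)"
proof (induction j)
  case 0
  show ?case
  proof (rule Hausdorff_space_separating_maps)
    fix x y assume *: "x \<in> topspace (it_space X 0)" "y \<in> topspace (it_space X 0)" "x \<noteq> y"
    then have "pt x \<noteq> pt y" by (auto elim!: topspace_it_space_0E)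
    moreover have "continuous_map (it_space X 0) (topo X) pt"
      using continuous_map_pt[OF continuous_map_id] by (simp add: id_def)
    ultimately show "\<exists>f. continuous_map (it_space X 0) (topo X) f \<and> f x \<noteq> f y" by blast
  qed (rule assms)
next
  case (Suc j)
  let ?P = "prod_topology (it_space X j) (prod_topology (it_space X j) (euclidean :: 'b topology))"
  have id: "continuous_map (it_space X (Suc j)) (it_space X (Suc j)) (\<lambda>z. z)" by simp
  show ?case
  proof (rule Hausdorff_space_separating_maps)
    fix x y assume *: "x \<in> topspace (it_space X (Suc j))" "y \<in> topspace (it_space X (Suc j))" "x \<noteq> y"
    then have "(src x, dir x, par x) \<noteq> (src y, dir y, par y)" by (auto elim!: topspace_it_space_SucE)
    moreover have "continuous_map (it_space X (Suc j)) ?P (\<lambda>z. (src z, dir z, par z))"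
      by (intro continuous_map_pairedI continuous_map_src[OF id] continuous_map_dir[OF id] continuous_map_par[OF id])
    ultimately show "\<exists>f. continuous_map (it_space X (Suc j)) ?P f \<and> f x \<noteq> f y"
      by (intro exI[of _ "\<lambda>z. (src z, dir z, par z)"] conjI)
  next
    show "Hausdorff_space ?P"
      using Suc.IH by (simp add: Hausdorff_space_prod_topology Hausdorff_space_euclidean_t2)
  qed
qed

lemma Hausdorff_it_top: "Hausdorff_space (topo X) \<Longrightarrow> Hausdorff_space (it_top X U j)"
  unfolding it_top_def by (intro Hausdorff_space_subtopology Hausdorff_it_space)

text \<open>Off parameter \<open>0\<close> both functions are given by the same formula. At
  parameter \<open>0\<close> the values agree by continuity, because \<open>0\<close> is not
  isolated in the field and \<open>F\<close> is Hausdorff.\<close>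

lemma is_dq_unique:
  fixes X :: "('k::topological_field, 'v::ab_group_add) tvs"
  assumes X: "tvs X" and U: "openin (topo X) U" and F: "Hausdorff_space (topo F)"
    and 1: "is_dq X U F j h g1" and 2: "is_dq X U F j h g2" and z: "z \<in> it_set X U (Suc j)"
  shows "g1 z = g2 z"
proof -
  let ?T = "it_top X U (Suc j)"
  obtain x y t where xyt: "z = Ext x y t" "x \<in> it_set X U j" "y \<in> topspace (it_space X j)"
    using z by (elim it_set_SucE)
  have xs: "x \<in> topspace (it_space X j)" using xyt(2) openin_subset[OF openin_it_set[OF X U]] by blast
  have eq: "g1 (Ext x y s) = g2 (Ext x y s)" if "s \<noteq> 0" "Ext x y s \<in> it_set X U (Suc j)" for s
    using 1 2 that by (simp add: is_dq_def del: mem_it_set)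
  \<comment> \<open>The admissible parameters for fixed base point and direction. On this open
    subset of the field the two candidates become continuous maps of one variable.\<close>
  define O' where "O' = {s :: 'k. Ext x y s \<in> it_set X U (Suc j)}"
  have e: "continuous_map euclidean (it_space X (Suc j)) (\<lambda>s. Ext x y s)"
    using xs xyt(3) by (intro continuous_map_Ext) auto
  have O': "open O'"
    using openin_continuous_map_preimage[OF e openin_it_set[OF X U, of "Suc j"]]
    by (simp add: O'_def del: mem_it_set)
  have e': "continuous_map (top_of_set O') ?T (\<lambda>s. Ext x y s)"
    unfolding it_top_def
    by (intro continuous_map_into_subtopology continuous_map_from_subtopology e) (auto simp: O'_def)
  have g: "continuous_map (top_of_set O') (topo F) (\<lambda>s. g1 (Ext x y s))"
    "continuous_map (top_of_set O') (topo F) (\<lambda>s. g2 (Ext x y s))"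
    using continuous_map_compose[OF e'] 1 2 by (auto simp: is_dq_def o_def)
  show ?thesis
  proof (cases "t = 0")
    case True
    have "0 \<in> top_of_set O' closure_of (O' - {0})"
      unfolding in_closure_of
    proof (intro conjI allI impI)
      show "0 \<in> topspace (top_of_set O')" using z xyt(1) True by (simp add: O'_def del: mem_it_set)
      \<comment> \<open>An open set containing \<open>0\<close> cannot be \<open>{0}\<close>, so it
        meets the punctured set \<open>O' - {0}\<close>.\<close>
      fix T assume T: "0 \<in> T \<and> openin (top_of_set O') T"
      then have "open T" "T \<subseteq> O'" using O' by (auto simp: openin_open_eq)
      moreover have "T \<noteq> {0}" using not_open_singleton_field \<open>open T\<close> by blast
      ultimately show "\<exists>y. y \<in> O' - {0} \<and> y \<in> T" using T by blast
    qed
    from forall_in_closure_of_eq[OF this F g] eq show ?thesis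
      using xyt(1) True by (auto simp: O'_def simp del: mem_it_set)
  next
    case False
    then show ?thesis using eq z xyt(1) by blast
  qed
qed


section \<open>Uniqueness of difference quotients\<close>

lemma continuous_map_into_it_top:
  assumes "continuous_map Z (it_space X j) f" "\<And>z. z \<in> topspace Z \<Longrightarrow> f z \<in> it_set X U j"
  shows "continuous_map Z (it_top X U j) f"
  unfolding it_top_def using assms by (intro continuous_map_into_subtopology) auto

lemma continuous_map_it_top_incl: "continuous_map (it_top X U j) (it_space X j) (\<lambda>z. z)"
  unfolding it_top_def by (intro continuous_map_from_subtopology) simp

lemma it_top_mem: "z \<in> topspace (it_top X U j) \<Longrightarrow> z \<in> it_set X U j"
  by (simp add: it_top_def)

text \<open>\<open>Base\<close> and \<open>pt\<close> are mutually inverse homeomorphisms between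
  \<open>U\<close> and its copy among trees of height \<open>0\<close>, which lets order
  \<open>0\<close> be treated like the higher orders.\<close>

lemma C_fin_0_iff:
  "C_fin X U F 0 f \<longleftrightarrow> continuous_map (it_top X U 0) (topo F) (iter_dq X U F f 0)"
proof
  assume L: "C_fin X U F 0 f"
  have "continuous_map (it_top X U 0) (subtopology (topo X) U) pt"
    by (intro continuous_map_into_subtopology continuous_map_pt continuous_map_it_top_incl)
      (auto dest!: it_top_mem elim!: it_set_0E)
  from continuous_map_compose[OF this] L
  show "continuous_map (it_top X U 0) (topo F) (iter_dq X U F f 0)" by (simp add: o_def)
next
  assume R: "continuous_map (it_top X U 0) (topo F) (iter_dq X U F f 0)"
  have "continuous_map (subtopology (topo X) U) (it_top X U 0) Base"
    by (intro continuous_map_into_it_top continuous_map_Base continuous_map_from_subtopology) auto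
  from continuous_map_compose[OF this R] show "C_fin X U F 0 f" by (simp add: o_def)
qed

lemma C_fin_continuous_is_dq:
  assumes "C_fin X U F n f"
  shows "(\<forall>i\<le>n. continuous_map (it_top X U i) (topo F) (iter_dq X U F f i)) \<and>
    (\<forall>i<n. is_dq X U F i (iter_dq X U F f i) (iter_dq X U F f (Suc i)))"
  using assms
proof (induction n)
  case 0
  then show ?case by (simp add: C_fin_0_iff del: iter_dq.simps C_fin.simps)
next
  case (Suc n)
  then have IH: "\<forall>i\<le>n. continuous_map (it_top X U i) (topo F) (iter_dq X U F f i)"
    "\<forall>i<n. is_dq X U F i (iter_dq X U F f i) (iter_dq X U F f (Suc i))" by simp_all
  \<comment> \<open>The existence clause in \<open>C_fin\<close> makes \<open>SOME\<close> return a
    genuine difference quotient.\<close>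
  have "is_dq X U F n (iter_dq X U F f n) (iter_dq X U F f (Suc n))"
    using someI_ex[of "is_dq X U F n (iter_dq X U F f n)"] Suc.prems by simp
  moreover from this have "continuous_map (it_top X U (Suc n)) (topo F) (iter_dq X U F f (Suc n))"
    unfolding is_dq_def by (rule conjunct1)
  ultimately show ?case using IH by (auto simp: le_Suc_eq less_Suc_eq simp del: iter_dq.simps)
qed

lemma C_fin_continuous:
  "C_fin X U F n f \<Longrightarrow> i \<le> n \<Longrightarrow> continuous_map (it_top X U i) (topo F) (iter_dq X U F f i)"
  using C_fin_continuous_is_dq by blast

lemma iter_dq_Ext:
  assumes "C_fin X U F n f" "i < n" "Ext x y t \<in> it_set X U (Suc i)" "t \<noteq> 0"
  shows "iter_dq X U F f (Suc i) (Ext x y t) =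
    scl F (1 / t) (iter_dq X U F f i (shift X x t y) - iter_dq X U F f i x)"
proof -
  have "is_dq X U F i (iter_dq X U F f i) (iter_dq X U F f (Suc i))"
    using C_fin_continuous_is_dq[OF assms(1)] assms(2) by blast
  then show ?thesis using assms(3,4) unfolding is_dq_def by blast
qed

text \<open>The criterion that takes the place of the chain rule: a sequence \<open>h\<close> of
  continuous functions, each satisfying the quotient relation with respect to its predecessor,
  proves regularity and at the same time identifies the functions chosen by \<open>iter_dq\<close>.
  Identification on \<open>it_set\<close> is all that uniqueness can give, and all that the next
  step needs.\<close>

lemma C_finI_dq:
  fixes X :: "('k::topological_field, 'v::ab_group_add) tvs"
  assumes X: "tvs X" and U: "openin (topo X) U" and F: "Hausdorff_space (topo F)"
    and 0: "\<And>x. x \<in> U \<Longrightarrow> h 0 (Base x) = f x"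
    and cont: "\<And>i. i \<le> n \<Longrightarrow> continuous_map (it_top X U i) (topo F) (h i)"
    and dq: "\<And>i x y t. i < n \<Longrightarrow> Ext x y t \<in> it_set X U (Suc i) \<Longrightarrow> t \<noteq> 0 \<Longrightarrow>
      h (Suc i) (Ext x y t) = scl F (1 / t) (h i (shift X x t y) - h i x)"
  shows "C_fin X U F n f \<and> (\<forall>i\<le>n. \<forall>z\<in>it_set X U i. iter_dq X U F f i z = h i z)"
proof -
  have "C_fin X U F m f \<and> (\<forall>i\<le>m. \<forall>z\<in>it_set X U i. iter_dq X U F f i z = h i z)" if "m \<le> n" for m
    using that
  proof (induction m)
    case 0
    have eq: "iter_dq X U F f 0 z = h 0 z" if "z \<in> it_set X U 0" for z
      using that assms(4) by (auto elim!: it_set_0E)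
    have "continuous_map (it_top X U 0) (topo F) (iter_dq X U F f 0)"
      by (rule continuous_map_eq[OF cont[OF 0]]) (auto dest!: it_top_mem eq simp del: iter_dq.simps)
    then show ?case using eq unfolding C_fin_0_iff by blast
  next
    case (Suc m)
    then have IH: "C_fin X U F m f" "\<And>i z. i \<le> m \<Longrightarrow> z \<in> it_set X U i \<Longrightarrow> iter_dq X U F f i z = h i z"
      and m: "m < n" by auto
    \<comment> \<open>The relation \<open>dq\<close> is stated for \<open>h m\<close>; both
      \<open>x\<close> and its shift lie in \<open>it_set X U m\<close>, where the induction
      hypothesis replaces \<open>h m\<close> by the chosen quotient.\<close>
    have h: "is_dq X U F m (iter_dq X U F f m) (h (Suc m))"
      unfolding is_dq_def
    proof (intro conjI allI impI)
      show "continuous_map (it_top X U (Suc m)) (topo F) (h (Suc m))" by (rule cont[OF Suc.prems])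
      fix x y t assume "Ext x y t \<in> it_set X U (Suc m)" "t \<noteq> (0 :: 'k)"
      then show "h (Suc m) (Ext x y t) = scl F (1 / t) (iter_dq X U F f m (shift X x t y) - iter_dq X U F f m x)"
        using dq[OF m] IH(2)[of m] by simp
    qed
    then have C: "C_fin X U F (Suc m) f"
      using IH(1) C_fin_continuous[OF IH(1) order_refl] by auto
    have "is_dq X U F m (iter_dq X U F f m) (iter_dq X U F f (Suc m))"
      using C_fin_continuous_is_dq[OF C] by blast
    then have "iter_dq X U F f (Suc m) z = h (Suc m) z" if "z \<in> it_set X U (Suc m)" for z
      using is_dq_unique[OF X U F _ h that] by blast
    then show ?case using C IH(2) by (auto simp: le_Suc_eq simp del: iter_dq.simps C_fin.simps)
  qed
  then show ?thesis by blast
qed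

text \<open>The criterion above with the difference quotients of \<open>f\<close> as the sequence:
  agreement with \<open>g\<close> is required only at height \<open>0\<close>.\<close>

lemma C_fin_cong:
  assumes "tvs X" "openin (topo X) U" "Hausdorff_space (topo F)"
    and C: "C_fin X U F n f" and eq: "\<And>x. x \<in> U \<Longrightarrow> g x = f x"
  shows "C_fin X U F n g \<and> (\<forall>i\<le>n. \<forall>z\<in>it_set X U i. iter_dq X U F g i z = iter_dq X U F f i z)"
  by (rule C_finI_dq[OF assms(1-3) _ C_fin_continuous[OF C] iter_dq_Ext[OF C]]) (simp add: eq)

lemma C_on_cong:
  assumes "tvs X" "openin (topo X) U" "Hausdorff_space (topo F)"
    and "C_on l X U F f" "\<And>x. x \<in> U \<Longrightarrow> g x = f x"
  shows "C_on l X U F g"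
  using assms(4) C_fin_cong[where f = f and g = g, OF assms(1-3) _ assms(5)] unfolding C_on_def by blast

section \<open>Products of spaces and of differentiable maps\<close>

lemma scl_prod_tvs [simp]: "scl (prod_tvs X Y) t (x, y) = (scl X t x, scl Y t y)"
  and topo_prod_tvs [simp]: "topo (prod_tvs X Y) = prod_topology (topo X) (topo Y)"
  by (simp_all add: prod_tvs_def)

lemma tvs_prod_tvs:
  assumes X: "tvs X" and Y: "tvs Y"
  shows "tvs (prod_tvs X Y)"
proof -
  note projs =
    continuous_map_compose[OF continuous_map_fst continuous_map_fst, unfolded o_def]
    continuous_map_compose[OF continuous_map_fst continuous_map_snd, unfolded o_def]
    continuous_map_compose[OF continuous_map_snd continuous_map_fst, unfolded o_def]
    continuous_map_compose[OF continuous_map_snd continuous_map_snd, unfolded o_def]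
  have vs: "vector_space (scl (prod_tvs X Y))"
    by (unfold_locales) (auto simp: tvs_scl[OF X] tvs_scl[OF Y])
  then have "module (scl (prod_tvs X Y))" by (simp add: module_iff_vector_space)
  then have "module.subspace (scl (prod_tvs X Y)) (topspace (topo (prod_tvs X Y)))"
    by (auto simp: module.subspace_def zero_prod_def tvs_topspace[OF X] tvs_topspace[OF Y])
  moreover have "Hausdorff_space (topo (prod_tvs X Y))"
    using tvs_Hausdorff[OF X] tvs_Hausdorff[OF Y] by (simp add: Hausdorff_space_prod_topology)
  moreover have "continuous_map (prod_topology (topo (prod_tvs X Y)) (topo (prod_tvs X Y))) (topo (prod_tvs X Y))
      (\<lambda>(x, y). x + y)"
  proof -
    let ?P = "prod_topology (topo X) (topo Y)"
    have "continuous_map (prod_topology ?P ?P) ?P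
        (\<lambda>z. (fst (fst z) + fst (snd z), snd (fst z) + snd (snd z)))"
      by (intro continuous_map_pairedI tvs_continuous_add[OF X] tvs_continuous_add[OF Y] projs)
    then show ?thesis by (simp add: case_prod_unfold plus_prod_def)
  qed
  moreover have "continuous_map (prod_topology euclidean (topo (prod_tvs X Y))) (topo (prod_tvs X Y))
      (\<lambda>(t, x). scl (prod_tvs X Y) t x)"
  proof -
    let ?P = "prod_topology (topo X) (topo Y)"
    have "continuous_map (prod_topology euclidean ?P) ?P
        (\<lambda>z. (scl X (fst z) (fst (snd z)), scl Y (fst z) (snd (snd z))))"
      by (intro continuous_map_pairedI tvs_continuous_scl[OF X] tvs_continuous_scl[OF Y] projs continuous_map_fst)
    then show ?thesis by (simp add: case_prod_unfold prod_tvs_def)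
  qed
  ultimately show ?thesis using vs by (simp add: tvs_def)
qed


text \<open>Applying a linear map to the leaves and keeping the parameters is the linear map it
  induces on the iterated spaces. The instances that matter are the two projections of a
  product.\<close>

lemma map_itpoint_shift:
  assumes lin: "\<And>v w t. v \<in> topspace (topo X) \<Longrightarrow> w \<in> topspace (topo X) \<Longrightarrow>
      \<phi> (v + scl X t w) = \<phi> v + scl X' t (\<phi> w)"
    and "x \<in> topspace (it_space X j)" "y \<in> topspace (it_space X j)"
  shows "map_itpoint \<phi> (\<lambda>t. t) (shift X x t y) = shift X' (map_itpoint \<phi> (\<lambda>t. t) x) t (map_itpoint \<phi> (\<lambda>t. t) y)"
  using assms(2,3)
proof (induction j arbitrary: x y)
  case 0
  then show ?case by (auto elim!: topspace_it_space_0E simp: lin)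
next
  case (Suc j)
  then show ?case by (auto elim!: topspace_it_space_SucE)
qed

lemma map_itpoint_it_set:
  assumes X: "tvs X" and X': "tvs X'"
    and lin: "\<And>v w t. v \<in> topspace (topo X) \<Longrightarrow> w \<in> topspace (topo X) \<Longrightarrow>
      \<phi> (v + scl X t w) = \<phi> v + scl X' t (\<phi> w)"
    and \<phi>: "\<phi> ` topspace (topo X) \<subseteq> topspace (topo X')"
    and U: "U \<subseteq> topspace (topo X)" "\<phi> ` U \<subseteq> U'" and z: "z \<in> it_set X U j"
  shows "map_itpoint \<phi> (\<lambda>t. t) z \<in> it_set X' U' j"
proof -
  have top: "map_itpoint \<phi> (\<lambda>t. t) z \<in> topspace (it_space X' j)" if "z \<in> topspace (it_space X j)" for z j
    using that
  proof (induction j arbitrary: z)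
    case 0
    then show ?case using \<phi> by (auto elim!: topspace_it_space_0E)
  next
    case (Suc j)
    then show ?case by (auto elim!: topspace_it_space_SucE)
  qed
  show ?thesis
    using z
  proof (induction j arbitrary: z)
    case 0
    then show ?case using U by (auto elim!: it_set_0E)
  next
    case (Suc j)
    from Suc.prems obtain x y t where z: "z = Ext x y t" "x \<in> it_set X U j" "y \<in> topspace (it_space X j)"
      "shift X x t y \<in> it_set X U j" by (elim it_set_SucE)
    have "x \<in> topspace (it_space X j)" using z(2) it_set_subset[OF X U(1)] by blast
    from map_itpoint_shift[of X \<phi> X', OF lin this z(3)]
    show ?case using z Suc.IH[OF z(2)] Suc.IH[OF z(4)] top[OF z(3)] by simp
  qed
qed

lemma continuous_map_map_itpoint:
  assumes \<phi>: "continuous_map (topo X) (topo X') \<phi>" and "continuous_map Z (it_space X j) f"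
  shows "continuous_map Z (it_space X' j) (\<lambda>z. map_itpoint \<phi> (\<lambda>t. t) (f z))"
  using assms(2)
proof (induction j arbitrary: f)
  case 0
  have "continuous_map Z (it_space X' 0) (\<lambda>z. Base (\<phi> (pt (f z))))"
    using continuous_map_compose[OF continuous_map_pt[OF 0] \<phi>] by (intro continuous_map_Base) (simp add: o_def)
  then show ?case
  proof (rule continuous_map_eq)
    fix z assume "z \<in> topspace Z"
    from topspace_it_space_0E[OF continuous_map_it_space_mem[OF 0 this]]
    show "Base (\<phi> (pt (f z))) = map_itpoint \<phi> (\<lambda>t. t) (f z)" by (metis itpoint.sel(1) itpoint.map(1))
  qed
next
  case (Suc j)
  have "continuous_map Z (it_space X' (Suc j)) (\<lambda>z. Ext (map_itpoint \<phi> (\<lambda>t. t) (src (f z)))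
      (map_itpoint \<phi> (\<lambda>t. t) (dir (f z))) (par (f z)))"
    by (intro continuous_map_Ext Suc.IH continuous_map_src[OF Suc.prems] continuous_map_dir[OF Suc.prems]
        continuous_map_par[OF Suc.prems])
  then show ?case
  proof (rule continuous_map_eq)
    fix z assume "z \<in> topspace Z"
    from topspace_it_space_SucE[OF continuous_map_it_space_mem[OF Suc.prems this]]
    obtain x y t where "f z = Ext x y t" by metis
    then show "Ext (map_itpoint \<phi> (\<lambda>t. t) (src (f z))) (map_itpoint \<phi> (\<lambda>t. t) (dir (f z))) (par (f z)) =
        map_itpoint \<phi> (\<lambda>t. t) (f z)" by simp
  qed
qed

lemma
  assumes X: "tvs X" and Y: "tvs Y" and U: "openin (topo X) U" and V: "openin (topo Y) V"
  defines "P \<equiv> prod_tvs X Y"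
  shows map_fst_it_set: "z \<in> it_set P (U \<times> V) j \<Longrightarrow> map_itpoint fst (\<lambda>t. t) z \<in> it_set X U j"
    and map_snd_it_set: "z \<in> it_set P (U \<times> V) j \<Longrightarrow> map_itpoint snd (\<lambda>t. t) z \<in> it_set Y V j"
    and map_fst_shift: "x \<in> topspace (it_space P j) \<Longrightarrow> y \<in> topspace (it_space P j) \<Longrightarrow>
      map_itpoint fst (\<lambda>t. t) (shift P x t y) = shift X (map_itpoint fst (\<lambda>t. t) x) t (map_itpoint fst (\<lambda>t. t) y)"
    and map_snd_shift: "x \<in> topspace (it_space P j) \<Longrightarrow> y \<in> topspace (it_space P j) \<Longrightarrow>
      map_itpoint snd (\<lambda>t. t) (shift P x t y) = shift Y (map_itpoint snd (\<lambda>t. t) x) t (map_itpoint snd (\<lambda>t. t) y)"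
    and continuous_map_map_fst: "continuous_map (it_top P (U \<times> V) j) (it_top X U j) (map_itpoint fst (\<lambda>t. t))"
    and continuous_map_map_snd: "continuous_map (it_top P (U \<times> V) j) (it_top Y V j) (map_itpoint snd (\<lambda>t. t))"
proof -
  have P: "tvs P" unfolding P_def by (rule tvs_prod_tvs[OF X Y])
  have sub: "U \<times> V \<subseteq> topspace (topo P)"
    using openin_subset[OF U] openin_subset[OF V] by (auto simp: P_def)
  have lin: "fst (v + scl P t w) = fst v + scl X t (fst w)" "snd (v + scl P t w) = snd v + scl Y t (snd w)" for v w t
    by (cases v; cases w; simp add: P_def)+
  show 1: "map_itpoint fst (\<lambda>t. t) z \<in> it_set X U j" if "z \<in> it_set P (U \<times> V) j" for z
    by (rule map_itpoint_it_set[OF P X _ _ sub _ that]) (auto simp: P_def lin[unfolded P_def])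
  show 2: "map_itpoint snd (\<lambda>t. t) z \<in> it_set Y V j" if "z \<in> it_set P (U \<times> V) j" for z
    by (rule map_itpoint_it_set[OF P Y _ _ sub _ that]) (auto simp: P_def lin[unfolded P_def])
  show "map_itpoint fst (\<lambda>t. t) (shift P x t y) = shift X (map_itpoint fst (\<lambda>t. t) x) t (map_itpoint fst (\<lambda>t. t) y)"
    if "x \<in> topspace (it_space P j)" "y \<in> topspace (it_space P j)" for x y t
    by (rule map_itpoint_shift[OF lin(1) that])
  show "map_itpoint snd (\<lambda>t. t) (shift P x t y) = shift Y (map_itpoint snd (\<lambda>t. t) x) t (map_itpoint snd (\<lambda>t. t) y)"
    if "x \<in> topspace (it_space P j)" "y \<in> topspace (it_space P j)" for x y t
    by (rule map_itpoint_shift[OF lin(2) that])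
  show "continuous_map (it_top P (U \<times> V) j) (it_top X U j) (map_itpoint fst (\<lambda>t. t))"
    by (intro continuous_map_into_it_top continuous_map_map_itpoint[where X = P] continuous_map_it_top_incl)
      (auto simp: P_def continuous_map_fst dest!: it_top_mem intro!: 1[unfolded P_def])
  show "continuous_map (it_top P (U \<times> V) j) (it_top Y V j) (map_itpoint snd (\<lambda>t. t))"
    by (intro continuous_map_into_it_top continuous_map_map_itpoint[where X = P] continuous_map_it_top_incl)
      (auto simp: P_def continuous_map_snd dest!: it_top_mem intro!: 2[unfolded P_def])
qed

text \<open>The difference quotient of a product map is the pair of difference quotients of its
  factors, evaluated at the two projections of the tree. This is what makes product charts
  compatible with one another.\<close>

lemma C_on_map_prod:
  fixes X :: "('k::topological_field, 'v::ab_group_add) tvs"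
  assumes X: "tvs X" and Y: "tvs Y" and X': "tvs X'" and Y': "tvs Y'"
    and U: "openin (topo X) U" and V: "openin (topo Y) V"
    and f: "C_on l X U X' f" and g: "C_on l Y V Y' g"
  shows "C_on l (prod_tvs X Y) (U \<times> V) (prod_tvs X' Y') (map_prod f g)"
  unfolding C_on_def
proof (intro allI impI)
  fix n assume "enat n \<le> l"
  then have C: "C_fin X U X' n f" "C_fin Y V Y' n g" using f g by (simp_all add: C_on_def)
  let ?P = "prod_tvs X Y" and ?Q = "prod_tvs X' Y'"
  let ?a = "map_itpoint fst (\<lambda>t. t :: 'k)" and ?b = "map_itpoint snd (\<lambda>t. t :: 'k)"
  define h where "h i z = (iter_dq X U X' f i (?a z), iter_dq Y V Y' g i (?b z))" for i z
  have P: "tvs ?P" and UV: "openin (topo ?P) (U \<times> V)"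
    using tvs_prod_tvs[OF X Y] U V by (auto simp: openin_prod_Times_iff)
  have "C_fin ?P (U \<times> V) ?Q n (map_prod f g) \<and>
      (\<forall>i\<le>n. \<forall>z\<in>it_set ?P (U \<times> V) i. iter_dq ?P (U \<times> V) ?Q (map_prod f g) i z = h i z)"
  proof (rule C_finI_dq[OF P UV])
    show "Hausdorff_space (topo ?Q)" by (intro tvs_Hausdorff tvs_prod_tvs X' Y')
    show "h 0 (Base x) = map_prod f g x" if "x \<in> U \<times> V" for x
      by (cases x) (simp add: h_def)
    show "continuous_map (it_top ?P (U \<times> V) i) (topo ?Q) (h i)" if "i \<le> n" for i
      using continuous_map_compose[OF continuous_map_map_fst[OF X Y U V] C_fin_continuous[OF C(1) that]]
        continuous_map_compose[OF continuous_map_map_snd[OF X Y U V] C_fin_continuous[OF C(2) that]]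
      by (simp add: h_def[abs_def] continuous_map_pairedI o_def)
    fix i x y t assume i: "i < n" and z: "Ext x y t \<in> it_set ?P (U \<times> V) (Suc i)" and t: "t \<noteq> (0 :: 'k)"
    have y: "y \<in> topspace (it_space ?P i)" using z by simp
    have "x \<in> it_set ?P (U \<times> V) i" using z by simp
    then have x: "x \<in> topspace (it_space ?P i)" using openin_subset[OF openin_it_set[OF P UV]] by blast
    have "Ext (?a x) (?a y) t \<in> it_set X U (Suc i)" "Ext (?b x) (?b y) t \<in> it_set Y V (Suc i)"
      using map_fst_it_set[OF X Y U V z] map_snd_it_set[OF X Y U V z] by simp_all
    from iter_dq_Ext[OF C(1) i this(1) t] iter_dq_Ext[OF C(2) i this(2) t]
    show "h (Suc i) (Ext x y t) = scl ?Q (1 / t) (h i (shift ?P x t y) - h i x)"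
      by (simp add: h_def map_fst_shift[OF X Y U V x y] map_snd_shift[OF X Y U V x y] del: iter_dq.simps)
  qed
  then show "C_fin ?P (U \<times> V) ?Q n (map_prod f g)" ..
qed


section \<open>Difference quotients of partial maps\<close>

primrec it_zero :: "nat \<Rightarrow> ('v::zero, 'k::zero) itpoint" where
  "it_zero 0 = Base 0"
| "it_zero (Suc j) = Ext (it_zero j) (it_zero j) 0"

lemma it_zero_in: "tvs X \<Longrightarrow> it_zero j \<in> topspace (it_space X j)"
  by (induction j) (auto simp: tvs_zero_in)

lemma shift_it_zero:
  assumes "tvs X" "x \<in> topspace (it_space X j)"
  shows "shift X x t (it_zero j) = x"
  using assms(2)
  by (induction j arbitrary: x)
    (auto elim!: topspace_it_space_0E topspace_it_space_SucE simp: tvs_scl_zero_right[OF assms(1)])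

text \<open>\<open>graft_point u z\<close> is the point \<open>u\<close> of \<open>X\<^sup>[\<^sup>j\<^sup>]\<close> with \<open>z\<close> as second component of the base point and
  \<open>0\<close> as second component of all directions, so that \<open>h(\<cdot>, z)\<^sup>[\<^sup>j\<^sup>](u) = h\<^sup>[\<^sup>j\<^sup>](graft_point u z)\<close>.\<close>

primrec graft_point :: "('v, 'k) itpoint \<Rightarrow> 'w::zero \<Rightarrow> ('v \<times> 'w, 'k) itpoint" where
  "graft_point (Base x) z = Base (x, z)"
| "graft_point (Ext u v s) z = Ext (graft_point u z) (graft_point v 0) s"

text \<open>A tree \<open>w\<close> of height \<open>i\<close> over \<open>Y\<close> becomes one of height \<open>i + j\<close> over \<open>X \<times> Y\<close>: the base point
  carries \<open>u\<close> and the directions carry \<open>0 \<in> X\<^sup>[\<^sup>j\<^sup>]\<close>. This makes \<open>graft\<close> linear in \<open>(w, u)\<close>.\<close>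

primrec graft :: "('w::zero, 'k::zero) itpoint \<Rightarrow> nat \<Rightarrow> ('v::zero, 'k) itpoint \<Rightarrow> ('v \<times> 'w, 'k) itpoint" where
  "graft (Base z) j u = graft_point u z"
| "graft (Ext w w' s) j u = Ext (graft w j u) (graft w' j (it_zero j)) s"

context
  fixes X :: "('k::topological_field, 'v::ab_group_add) tvs" and Y :: "('k, 'w::ab_group_add) tvs"
  assumes X: "tvs X" and Y: "tvs Y"
begin

text \<open>Linearity in the tree and the second component together. All directions inside
  \<open>graft_point\<close> carry \<open>0\<close> in the second component, and
  \<open>0 + t 0 = 0\<close>, so only the innermost base point sees \<open>z\<close> and
  \<open>z'\<close>.\<close>

lemma shift_graft_point:
  assumes "u \<in> topspace (it_space X j)" "u' \<in> topspace (it_space X j)"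
  shows "shift (prod_tvs X Y) (graft_point u z) t (graft_point u' z') =
    graft_point (shift X u t u') (z + scl Y t z')"
  using assms
  by (induction j arbitrary: u u' z z')
    (auto elim!: topspace_it_space_0E topspace_it_space_SucE simp: tvs_scl_zero_right[OF Y])

lemma shift_graft:
  assumes "w \<in> topspace (it_space Y i)" "w' \<in> topspace (it_space Y i)"
    and "u \<in> topspace (it_space X j)" "u' \<in> topspace (it_space X j)"
  shows "shift (prod_tvs X Y) (graft w j u) t (graft w' j u') = graft (shift Y w t w') j (shift X u t u')"
  using assms
proof (induction i arbitrary: w w' u u')
  case 0
  then show ?case by (auto elim!: topspace_it_space_0E[where X = Y] simp: shift_graft_point)
next
  case (Suc i)
  then show ?case
    by (auto elim!: topspace_it_space_SucE[where X = Y] simp: it_zero_in[OF X] shift_it_zero[OF X])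
qed

lemma graft_point_in_it_space:
  assumes "u \<in> topspace (it_space X j)" "z \<in> topspace (topo Y)"
  shows "graft_point u z \<in> topspace (it_space (prod_tvs X Y) j)"
  using assms
  by (induction j arbitrary: u z)
    (auto elim!: topspace_it_space_0E topspace_it_space_SucE simp: tvs_zero_in[OF Y])

lemma graft_in_it_space:
  assumes "w \<in> topspace (it_space Y i)" "u \<in> topspace (it_space X j)"
  shows "graft w j u \<in> topspace (it_space (prod_tvs X Y) (i + j))"
  using assms
proof (induction i arbitrary: w u)
  case 0
  then show ?case by (auto elim!: topspace_it_space_0E[where X = Y] simp: graft_point_in_it_space)
next
  case (Suc i)
  then show ?case by (auto elim!: topspace_it_space_SucE[where X = Y] simp: it_zero_in[OF X])
qed

context
  fixes U V
  assumes U: "openin (topo X) U" and V: "openin (topo Y) V"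
begin

text \<open>Moving along a direction with second component \<open>0\<close> keeps \<open>z\<close>
  fixed, so the shifted point is again of the form \<open>graft_point u z\<close> with the same
  \<open>z\<close> in \<open>V\<close>.\<close>

lemma graft_point_in_it_set:
  assumes "u \<in> it_set X U j" "z \<in> V"
  shows "graft_point u z \<in> it_set (prod_tvs X Y) (U \<times> V) j"
  using assms(1)
proof (induction j arbitrary: u)
  case 0
  then show ?case using assms(2) by (auto elim!: it_set_0E)
next
  case (Suc j)
  then obtain a b t where u: "u = Ext a b t" "a \<in> it_set X U j" "b \<in> topspace (it_space X j)"
    "shift X a t b \<in> it_set X U j" by (elim it_set_SucE)
  have "a \<in> topspace (it_space X j)" using u(2) openin_subset[OF openin_it_set[OF X U]] by blast
  then show ?case using u
    by (simp add: Suc.IH graft_point_in_it_space tvs_zero_in[OF Y] shift_graft_point tvs_scl_zero_right[OF Y])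
qed

text \<open>A direction is grafted with \<open>it_zero j\<close>, so a shift changes
  \<open>w\<close> and leaves \<open>u\<close> where it is; both end points therefore stay over
  \<open>U \<times> V\<close>.\<close>

lemma graft_in_it_set:
  assumes "w \<in> it_set Y V i" "u \<in> it_set X U j"
  shows "graft w j u \<in> it_set (prod_tvs X Y) (U \<times> V) (i + j)"
  using assms(1)
proof (induction i arbitrary: w)
  case 0
  then show ?case using assms(2) by (auto elim!: it_set_0E simp: graft_point_in_it_set)
next
  case (Suc i)
  then obtain a b t where w: "w = Ext a b t" "a \<in> it_set Y V i" "b \<in> topspace (it_space Y i)"
    "shift Y a t b \<in> it_set Y V i" by (elim it_set_SucE)
  have "a \<in> topspace (it_space Y i)" using w(2) openin_subset[OF openin_it_set[OF Y V]] by blast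
  moreover have "u \<in> topspace (it_space X j)" using assms(2) openin_subset[OF openin_it_set[OF X U]] by blast
  ultimately show ?case using w
    by (simp add: Suc.IH graft_in_it_space it_zero_in[OF X] shift_graft shift_it_zero[OF X])
qed

end

lemma continuous_map_graft_point:
  assumes "continuous_map Z (it_space X j) f" "continuous_map Z (topo Y) g"
  shows "continuous_map Z (it_space (prod_tvs X Y) j) (\<lambda>z. graft_point (f z) (g z))"
  using assms
proof (induction j arbitrary: f g)
  case 0
  have "continuous_map Z (it_space (prod_tvs X Y) 0) (\<lambda>z. Base (pt (f z), g z))"
    using 0 by (intro continuous_map_Base) (simp add: continuous_map_pairedI continuous_map_pt)
  then show ?case
  proof (rule continuous_map_eq)
    fix z assume "z \<in> topspace Z"
    from topspace_it_space_0E[OF continuous_map_it_space_mem[OF 0(1) this]]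
    show "Base (pt (f z), g z) = graft_point (f z) (g z)" by (metis itpoint.sel(1) graft_point.simps(1))
  qed
next
  case (Suc j)
  have 0: "continuous_map Z (topo Y) (\<lambda>z. 0)" by (simp add: tvs_zero_in[OF Y])
  have "continuous_map Z (it_space (prod_tvs X Y) (Suc j))
      (\<lambda>z. Ext (graft_point (src (f z)) (g z)) (graft_point (dir (f z)) 0) (par (f z)))"
    by (intro continuous_map_Ext Suc.IH continuous_map_src[OF Suc.prems(1)] continuous_map_dir[OF Suc.prems(1)]
        continuous_map_par[OF Suc.prems(1)] Suc.prems(2) 0)
  then show ?case
  proof (rule continuous_map_eq)
    fix z assume "z \<in> topspace Z"
    from topspace_it_space_SucE[OF continuous_map_it_space_mem[OF Suc.prems(1) this]]
    obtain x y t where "f z = Ext x y t" by metis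
    then show "Ext (graft_point (src (f z)) (g z)) (graft_point (dir (f z)) 0) (par (f z)) =
        graft_point (f z) (g z)" by simp
  qed
qed

lemma continuous_map_graft:
  assumes "continuous_map Z (it_space Y i) g" "continuous_map Z (it_space X j) f"
  shows "continuous_map Z (it_space (prod_tvs X Y) (i + j)) (\<lambda>z. graft (g z) j (f z))"
  using assms
proof (induction i arbitrary: f g)
  case 0
  have "continuous_map Z (it_space (prod_tvs X Y) (0 + j)) (\<lambda>z. graft_point (f z) (pt (g z)))"
    using 0 by (simp add: continuous_map_graft_point continuous_map_pt)
  then show ?case
  proof (rule continuous_map_eq)
    fix z assume "z \<in> topspace Z"
    from topspace_it_space_0E[OF continuous_map_it_space_mem[OF 0(1) this]]
    show "graft_point (f z) (pt (g z)) = graft (g z) j (f z)" by (metis itpoint.sel(1) graft.simps(1))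
  qed
next
  case (Suc i)
  have 0: "continuous_map Z (it_space X j) (\<lambda>z. it_zero j)" by (simp add: it_zero_in[OF X])
  have "continuous_map Z (it_space (prod_tvs X Y) (Suc (i + j)))
      (\<lambda>z. Ext (graft (src (g z)) j (f z)) (graft (dir (g z)) j (it_zero j)) (par (g z)))"
    by (intro continuous_map_Ext Suc.IH continuous_map_src[OF Suc.prems(1)] continuous_map_dir[OF Suc.prems(1)]
        continuous_map_par[OF Suc.prems(1)] Suc.prems(2) 0)
  then have "continuous_map Z (it_space (prod_tvs X Y) (Suc (i + j))) (\<lambda>z. graft (g z) j (f z))"
  proof (rule continuous_map_eq)
    fix z assume "z \<in> topspace Z"
    from topspace_it_space_SucE[OF continuous_map_it_space_mem[OF Suc.prems(1) this]]
    obtain x y t where "g z = Ext x y t" by metis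
    then show "Ext (graft (src (g z)) j (f z)) (graft (dir (g z)) j (it_zero j)) (par (g z)) =
        graft (g z) j (f z)" by simp
  qed
  then show ?case by simp
qed

end

context
  fixes X :: "('k::topological_field, 'v::ab_group_add) tvs" and Y :: "('k, 'w::ab_group_add) tvs"
    and E :: "('k, 'e::ab_group_add) tvs" and U V
  assumes X: "tvs X" and Y: "tvs Y" and E: "tvs E"
    and U: "openin (topo X) U" and V: "openin (topo Y) V"
begin

lemma graft_it_top:
  "continuous_map (prod_topology (it_top X U j) (it_top Y V i)) (it_top (prod_tvs X Y) (U \<times> V) (i + j))
    (\<lambda>(u, w). graft w j u)"
proof (rule continuous_map_into_it_top)
  have "continuous_map (prod_topology (it_top X U j) (it_top Y V i)) (it_space (prod_tvs X Y) (i + j))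
      (\<lambda>z. graft (snd z) j (fst z))"
    by (intro continuous_map_graft[OF X Y]
        continuous_map_compose[OF continuous_map_fst continuous_map_it_top_incl, unfolded o_def]
        continuous_map_compose[OF continuous_map_snd continuous_map_it_top_incl, unfolded o_def])
  then show "continuous_map (prod_topology (it_top X U j) (it_top Y V i)) (it_space (prod_tvs X Y) (i + j))
      (\<lambda>(u, w). graft w j u)" by (simp add: case_prod_unfold)
qed (use X Y U V graft_in_it_set[OF X Y U V] in auto)

text \<open>Here \<open>f\<close> already uses up \<open>j\<close> quotients of \<open>h\<close> in
  the first variable, hence the order \<open>n + j\<close>. A further quotient at \<open>w\<close>
  in direction \<open>w'\<close> is one of \<open>h\<close> at \<open>graft w j u\<close> in a
  direction whose first part is zero, so the quotient relation for \<open>h\<close> is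
  inherited.\<close>

lemma C_fin_fixed_fst:
  assumes h: "C_fin (prod_tvs X Y) (U \<times> V) E (n + j) h" and u: "u \<in> it_set X U j"
  defines "f \<equiv> \<lambda>z. iter_dq (prod_tvs X Y) (U \<times> V) E h j (graft_point u z)"
  shows "C_fin Y V E n f \<and> (\<forall>i\<le>n. \<forall>w\<in>it_set Y V i.
    iter_dq Y V E f i w = iter_dq (prod_tvs X Y) (U \<times> V) E h (i + j) (graft w j u))"
proof (rule C_finI_dq[OF Y V tvs_Hausdorff[OF E]])
  show "iter_dq (prod_tvs X Y) (U \<times> V) E h (0 + j) (graft (Base z) j u) = f z" for z
    by (simp add: f_def)
  show "continuous_map (it_top Y V i) (topo E) (\<lambda>w. iter_dq (prod_tvs X Y) (U \<times> V) E h (i + j) (graft w j u))"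
    if "i \<le> n" for i
  proof -
    have "continuous_map (it_top Y V i) (prod_topology (it_top X U j) (it_top Y V i)) (\<lambda>w. (u, w))"
      using X U u by (intro continuous_map_pairedI) auto
    from continuous_map_compose[OF continuous_map_compose[OF this graft_it_top] C_fin_continuous[OF h]] that
    show ?thesis by (simp add: o_def)
  qed
  fix i w w' t assume i: "i < n" and w: "Ext w w' t \<in> it_set Y V (Suc i)" and t: "t \<noteq> (0 :: 'k)"
  have u': "u \<in> topspace (it_space X j)" using u openin_subset[OF openin_it_set[OF X U]] by blast
  have "w \<in> it_set Y V i" using w by simp
  then have "w \<in> topspace (it_space Y i)" using openin_subset[OF openin_it_set[OF Y V]] by blast
  \<comment> \<open>The direction has first part \<open>it_zero j\<close>, so linearity of
    \<open>graft\<close> moves \<open>w\<close> and fixes \<open>u\<close>.\<close>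
  then have "shift (prod_tvs X Y) (graft w j u) t (graft w' j (it_zero j)) = graft (shift Y w t w') j u"
    using w by (simp add: shift_graft[OF X Y] it_zero_in[OF X] u' shift_it_zero[OF X])
  moreover have "Ext (graft w j u) (graft w' j (it_zero j)) t \<in> it_set (prod_tvs X Y) (U \<times> V) (Suc (i + j))"
    using graft_in_it_set[OF X Y U V w u] by simp
  from iter_dq_Ext[OF h _ this t] i
  have "iter_dq (prod_tvs X Y) (U \<times> V) E h (Suc (i + j)) (Ext (graft w j u) (graft w' j (it_zero j)) t) =
    scl E (1 / t) (iter_dq (prod_tvs X Y) (U \<times> V) E h (i + j)
        (shift (prod_tvs X Y) (graft w j u) t (graft w' j (it_zero j))) -
      iter_dq (prod_tvs X Y) (U \<times> V) E h (i + j) (graft w j u))" by simp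
  ultimately show "iter_dq (prod_tvs X Y) (U \<times> V) E h (Suc i + j) (graft (Ext w w' t) j u) =
    scl E (1 / t) (iter_dq (prod_tvs X Y) (U \<times> V) E h (i + j) (graft (shift Y w t w') j u) -
      iter_dq (prod_tvs X Y) (U \<times> V) E h (i + j) (graft w j u))"
    by (simp del: iter_dq.simps)
qed

text \<open>Quotients of the partial map are quotients of \<open>h\<close> in directions with second
  component \<open>0\<close>, along which \<open>z\<close> does not move.\<close>

lemma C_fin_fixed_snd:
  assumes h: "C_fin (prod_tvs X Y) (U \<times> V) E n h" and z: "z \<in> V"
  shows "C_fin X U E n (\<lambda>x. h (x, z)) \<and> (\<forall>j\<le>n. \<forall>u\<in>it_set X U j.
    iter_dq X U E (\<lambda>x. h (x, z)) j u = iter_dq (prod_tvs X Y) (U \<times> V) E h j (graft_point u z))"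
proof (rule C_finI_dq[OF X U tvs_Hausdorff[OF E]])
  have zY: "z \<in> topspace (topo Y)" using z openin_subset[OF V] by blast
  show "iter_dq (prod_tvs X Y) (U \<times> V) E h 0 (graft_point (Base x) z) = h (x, z)" for x by simp
  show "continuous_map (it_top X U j) (topo E) (\<lambda>u. iter_dq (prod_tvs X Y) (U \<times> V) E h j (graft_point u z))"
    if "j \<le> n" for j
  proof -
    have "continuous_map (it_top X U j) (it_top (prod_tvs X Y) (U \<times> V) j) (\<lambda>u. graft_point u z)"
      using zY z by (intro continuous_map_into_it_top continuous_map_graft_point[OF X Y]
          continuous_map_it_top_incl graft_point_in_it_set[OF X Y U V]) (auto dest: it_top_mem)
    from continuous_map_compose[OF this C_fin_continuous[OF h that]] show ?thesis by (simp add: o_def)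
  qed
  fix j u u' t assume j: "j < n" and u: "Ext u u' t \<in> it_set X U (Suc j)" and t: "t \<noteq> (0 :: 'k)"
  have "u \<in> it_set X U j" using u by simp
  then have "u \<in> topspace (it_space X j)" using openin_subset[OF openin_it_set[OF X U]] by blast
  then have "shift (prod_tvs X Y) (graft_point u z) t (graft_point u' 0) = graft_point (shift X u t u') z"
    using u by (simp add: shift_graft_point[OF X Y] tvs_scl_zero_right[OF Y])
  moreover have "Ext (graft_point u z) (graft_point u' 0) t \<in> it_set (prod_tvs X Y) (U \<times> V) (Suc j)"
    using graft_point_in_it_set[OF X Y U V u z] by simp
  from iter_dq_Ext[OF h j this t]
  have "iter_dq (prod_tvs X Y) (U \<times> V) E h (Suc j) (Ext (graft_point u z) (graft_point u' 0) t) =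
    scl E (1 / t) (iter_dq (prod_tvs X Y) (U \<times> V) E h j
        (shift (prod_tvs X Y) (graft_point u z) t (graft_point u' 0)) -
      iter_dq (prod_tvs X Y) (U \<times> V) E h j (graft_point u z))" .
  ultimately show "iter_dq (prod_tvs X Y) (U \<times> V) E h (Suc j) (graft_point (Ext u u' t) z) =
    scl E (1 / t) (iter_dq (prod_tvs X Y) (U \<times> V) E h j (graft_point (shift X u t u') z) -
      iter_dq (prod_tvs X Y) (U \<times> V) E h j (graft_point u z))"
    by (simp del: iter_dq.simps)
qed

end


section \<open>Charts and function spaces\<close>

lemma continuous_map_local:
  assumes "\<And>x. x \<in> topspace T \<Longrightarrow> \<exists>U. openin T U \<and> x \<in> U \<and> continuous_map (subtopology T U) F f"
  shows "continuous_map T F f"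
proof -
  let ?I = "{U. openin T U \<and> continuous_map (subtopology T U) F f}"
  show ?thesis
    by (rule pasting_lemma[where I = ?I and T = "\<lambda>U. U" and f = "\<lambda>_. f"]) (use assms in auto)
qed

section \<open>Charts and product charts\<close>

lemma is_chartD:
  assumes "is_chart X T (U, \<kappa>)"
  shows is_chart_openin_dom: "openin T U"
    and is_chart_openin_image: "openin (topo X) (\<kappa> ` U)"
    and is_chart_inj_on: "inj_on \<kappa> U"
    and is_chart_continuous: "continuous_map (subtopology T U) (subtopology (topo X) (\<kappa> ` U)) \<kappa>"
    and is_chart_openin_Int: "openin T U' \<Longrightarrow> openin (topo X) (\<kappa> ` (U \<inter> U'))"
proof -
  have h: "openin T U" "openin (topo X) (\<kappa> ` U)"
    "homeomorphic_map (subtopology T U) (subtopology (topo X) (\<kappa> ` U)) \<kappa>"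
    using assms by (simp_all add: is_chart_def)
  then show "openin T U" "openin (topo X) (\<kappa> ` U)" by simp_all
  have "topspace (subtopology T U) = U" using openin_subset[OF h(1)] by auto
  then show "inj_on \<kappa> U" using homeomorphic_imp_injective_map[OF h(3)] by simp
  show "continuous_map (subtopology T U) (subtopology (topo X) (\<kappa> ` U)) \<kappa>"
    using h(3) by (rule homeomorphic_imp_continuous_map)
  assume U': "openin T U'"
  have "openin (subtopology T U) (U \<inter> U')"
    using h(1) U' by (simp add: openin_open_subtopology openin_Int)
  then have "openin (subtopology (topo X) (\<kappa> ` U)) (\<kappa> ` (U \<inter> U'))"
    using homeomorphic_imp_open_map[OF h(3)] by (simp add: open_map_def)
  then show "openin (topo X) (\<kappa> ` (U \<inter> U'))" using h(2) by (rule openin_trans_full)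
qed

lemma is_chart_prod:
  assumes "is_chart X S (U, \<kappa>)" "is_chart Y T (V, \<mu>)"
  shows "is_chart (prod_tvs X Y) (prod_topology S T) (U \<times> V, map_prod \<kappa> \<mu>)"
proof -
  have h: "openin S U" "openin (topo X) (\<kappa> ` U)"
    "homeomorphic_map (subtopology S U) (subtopology (topo X) (\<kappa> ` U)) \<kappa>"
    "openin T V" "openin (topo Y) (\<mu> ` V)"
    "homeomorphic_map (subtopology T V) (subtopology (topo Y) (\<mu> ` V)) \<mu>"
    using assms by (simp_all add: is_chart_def)
  have im: "map_prod \<kappa> \<mu> ` (U \<times> V) = \<kappa> ` U \<times> \<mu> ` V" by (rule map_prod_surj_on) simp_all
  obtain \<kappa>' \<mu>' where "homeomorphic_maps (subtopology S U) (subtopology (topo X) (\<kappa> ` U)) \<kappa> \<kappa>'"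
    "homeomorphic_maps (subtopology T V) (subtopology (topo Y) (\<mu> ` V)) \<mu> \<mu>'"
    using h(3,6) unfolding homeomorphic_map_maps by blast
  then have "homeomorphic_maps (prod_topology (subtopology S U) (subtopology T V))
      (prod_topology (subtopology (topo X) (\<kappa> ` U)) (subtopology (topo Y) (\<mu> ` V)))
      (\<lambda>(x, y). (\<kappa> x, \<mu> y)) (\<lambda>(x, y). (\<kappa>' x, \<mu>' y))"
    by (simp add: homeomorphic_maps_prod)
  then have "homeomorphic_map (prod_topology (subtopology S U) (subtopology T V))
      (prod_topology (subtopology (topo X) (\<kappa> ` U)) (subtopology (topo Y) (\<mu> ` V))) (map_prod \<kappa> \<mu>)"
    unfolding homeomorphic_map_maps map_prod_def by blast
  then show ?thesis
    using h by (simp add: is_chart_def im subtopology_Times openin_prod_Times_iff)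
qed

lemma the_inv_into_map_prod:
  assumes "inj_on \<kappa> U" "inj_on \<mu> V" "x \<in> \<kappa> ` U" "y \<in> \<mu> ` V"
  shows "the_inv_into (U \<times> V) (map_prod \<kappa> \<mu>) (x, y) = (the_inv_into U \<kappa> x, the_inv_into V \<mu> y)"
proof (rule the_inv_into_f_eq)
  show "inj_on (map_prod \<kappa> \<mu>) (U \<times> V)" using assms(1,2) by (auto simp: inj_on_def)
  show "map_prod \<kappa> \<mu> (the_inv_into U \<kappa> x, the_inv_into V \<mu> y) = (x, y)"
    using assms by (simp add: f_the_inv_into_f)
  show "(the_inv_into U \<kappa> x, the_inv_into V \<mu> y) \<in> U \<times> V"
    using assms by (auto simp: the_inv_into_f_f)
qed

lemma C_transition_prod:
  assumes X: "tvs X" and Y: "tvs Y"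
    and c: "is_chart X S (U, \<kappa>)" "is_chart X S (U', \<kappa>')" "is_chart Y T (V, \<mu>)" "is_chart Y T (V', \<mu>')"
    and t: "C_transition l X (U, \<kappa>) (U', \<kappa>')" "C_transition l Y (V, \<mu>) (V', \<mu>')"
  shows "C_transition l (prod_tvs X Y) (U \<times> V, map_prod \<kappa> \<mu>) (U' \<times> V', map_prod \<kappa>' \<mu>')"
proof -
  let ?f = "\<kappa>' \<circ> the_inv_into U \<kappa>" and ?g = "\<mu>' \<circ> the_inv_into V \<mu>"
  let ?A = "\<kappa> ` (U \<inter> U')" and ?B = "\<mu> ` (V \<inter> V')"
  have A: "openin (topo X) ?A" by (rule is_chart_openin_Int[OF c(1) is_chart_openin_dom[OF c(2)]])
  have B: "openin (topo Y) ?B" by (rule is_chart_openin_Int[OF c(3) is_chart_openin_dom[OF c(4)]])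
  have P: "tvs (prod_tvs X Y)" by (rule tvs_prod_tvs[OF X Y])
  have C: "C_on l (prod_tvs X Y) (?A \<times> ?B) (prod_tvs X Y) (map_prod ?f ?g)"
    using t by (intro C_on_map_prod X Y A B) (simp_all add: C_transition_def)
  have "C_on l (prod_tvs X Y) (?A \<times> ?B) (prod_tvs X Y)
      (map_prod \<kappa>' \<mu>' \<circ> the_inv_into (U \<times> V) (map_prod \<kappa> \<mu>))"
  proof (rule C_on_cong[OF P _ tvs_Hausdorff[OF P] C])
    show "openin (topo (prod_tvs X Y)) (?A \<times> ?B)" using A B by (simp add: openin_prod_Times_iff)
    fix z assume "z \<in> ?A \<times> ?B"
    then obtain x y where z: "z = (x, y)" "x \<in> \<kappa> ` U" "y \<in> \<mu> ` V" by blast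
    show "(map_prod \<kappa>' \<mu>' \<circ> the_inv_into (U \<times> V) (map_prod \<kappa> \<mu>)) z = map_prod ?f ?g z"
      using the_inv_into_map_prod[OF is_chart_inj_on[OF c(1)] is_chart_inj_on[OF c(3)] z(2,3)] z(1) by simp
  qed
  moreover have "map_prod \<kappa> \<mu> ` (U \<times> V \<inter> U' \<times> V') = ?A \<times> ?B"
    unfolding Times_Int_Times by (rule map_prod_surj_on) simp_all
  ultimately show ?thesis by (simp add: C_transition_def)
qed

lemma manifold_tvs: "manifold l M \<Longrightarrow> tvs (model M)"
  by (simp add: manifold_def)

lemma manifold_is_chart: "manifold l M \<Longrightarrow> c \<in> charts M \<Longrightarrow> is_chart (model M) (mtop M) c"
  by (simp add: manifold_def atlas_def)

lemma manifold_chart_cover: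
  assumes "manifold l M" "x \<in> topspace (mtop M)"
  obtains U \<kappa> where "(U, \<kappa>) \<in> charts M" "x \<in> U"
proof -
  have "x \<in> (\<Union>c\<in>charts M. fst c)" using assms by (simp add: manifold_def atlas_def)
  then show thesis using that by auto
qed

text \<open>The charts of \<open>prod_mfd\<close> form a maximal atlas; product charts belong to it
  because their mutual transition maps are products of transition maps. Membership is what allows
  regularity and the topology of maps on the product manifold to be read off over
  \<open>U \<times> V\<close>.\<close>

lemma prod_chart_in_charts:
  assumes M: "manifold l M" and N: "manifold l N" and c: "(U, \<kappa>) \<in> charts M" "(V, \<mu>) \<in> charts N"
  shows "(U \<times> V, map_prod \<kappa> \<mu>) \<in> charts (prod_mfd l M N)"
proof -
  have tr: "C_transition l (model M) a b" if "a \<in> charts M" "b \<in> charts M" for a b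
    using M that by (simp add: manifold_def atlas_def)
  have tr': "C_transition l (model N) a b" if "a \<in> charts N" "b \<in> charts N" for a b
    using N that by (simp add: manifold_def atlas_def)
  note ch = manifold_is_chart[OF M] manifold_is_chart[OF N]
  show ?thesis
    unfolding prod_mfd_def mfd.simps maximal_atlas_def
    using c by (auto intro!: is_chart_prod C_transition_prod manifold_tvs[OF M] manifold_tvs[OF N] ch tr tr')
qed

lemma chart_rep_apply: "inj_on \<kappa> U \<Longrightarrow> x \<in> U \<Longrightarrow> chart_rep (U, \<kappa>) f (\<kappa> x) = f x"
  by (simp add: chart_rep_def the_inv_into_f_f)

text \<open>For \<open>x\<close> outside the image of \<open>\<kappa>\<close> both sides are
  \<open>0\<close> by the convention of extending by zero. Thus, for fixed \<open>z\<close>, the two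
  sides agree as functions of \<open>x\<close> on the whole type, and \<open>iter_dq\<close> may be
  rewritten with them.\<close>

lemma chart_rep_prod_apply:
  assumes "inj_on \<kappa> U" "inj_on \<mu> V" "z \<in> \<mu> ` V"
  shows "chart_rep (U \<times> V, map_prod \<kappa> \<mu>) f (x, z) =
    chart_rep (U, \<kappa>) (\<lambda>x. f (x, the_inv_into V \<mu> z)) x"
proof -
  have "map_prod \<kappa> \<mu> ` (U \<times> V) = \<kappa> ` U \<times> \<mu> ` V" by (rule map_prod_surj_on) simp_all
  then show ?thesis using assms by (simp add: chart_rep_def the_inv_into_map_prod)
qed

text \<open>Order \<open>0\<close> is contained in every \<open>C_on r\<close>, so the local
  representatives are continuous; since charts are homeomorphisms onto their images and cover the
  manifold, continuity of \<open>f\<close> follows by pasting.\<close>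

lemma C_mapsI:
  assumes M: "manifold l M"
    and C: "\<And>U \<kappa>. (U, \<kappa>) \<in> charts M \<Longrightarrow> C_on r (model M) (\<kappa> ` U) F (chart_rep (U, \<kappa>) f)"
    and 0: "\<And>x. x \<notin> topspace (mtop M) \<Longrightarrow> f x = 0"
  shows "f \<in> C_maps r M F"
proof -
  have "continuous_map (mtop M) (topo F) f"
  proof (rule continuous_map_local)
    fix x assume "x \<in> topspace (mtop M)"
    from manifold_chart_cover[OF M this] obtain U \<kappa> where c: "(U, \<kappa>) \<in> charts M" "x \<in> U" .
    note ch = manifold_is_chart[OF M c(1)]
    have "C_fin (model M) (\<kappa> ` U) F 0 (chart_rep (U, \<kappa>) f)"
      using C[OF c(1)] unfolding C_on_def by (simp add: zero_enat_def[symmetric] del: C_fin.simps)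
    then have "continuous_map (subtopology (topo (model M)) (\<kappa> ` U)) (topo F) (chart_rep (U, \<kappa>) f)" by simp
    from continuous_map_compose[OF is_chart_continuous[OF ch] this]
    have "continuous_map (subtopology (mtop M) U) (topo F) f"
      by (rule continuous_map_eq) (simp add: chart_rep_apply[OF is_chart_inj_on[OF ch]])
    then show "\<exists>U. openin (mtop M) U \<and> x \<in> U \<and> continuous_map (subtopology (mtop M) U) (topo F) f"
      using is_chart_openin_dom[OF ch] c(2) by blast
  qed
  then show ?thesis using C 0 unfolding C_maps_def by blast
qed

lemma C_mapsD:
  assumes "f \<in> C_maps r M F"
  shows C_maps_chart: "(U, \<kappa>) \<in> charts M \<Longrightarrow> C_on r (model M) (\<kappa> ` U) F (chart_rep (U, \<kappa>) f)"
    and C_maps_outside: "x \<notin> topspace (mtop M) \<Longrightarrow> f x = 0"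
  using assms unfolding C_maps_def by blast+

section \<open>The topology on spaces of differentiable maps\<close>

lemma topo_C_space:
  "topo (C_space r M F) = initial_topology (C_maps r M F) (charts M) chart_rep
    (\<lambda>(U, \<kappa>). C_top r (model M) (\<kappa> ` U) F)"
  and scl_C_space: "scl (C_space r M F) t f x = scl F t (f x)"
  by (simp_all add: C_space_def)

lemma topspace_C_space [simp]: "topspace (topo (C_space r M F)) = C_maps r M F"
  by (simp add: topo_C_space)

lemma topspace_C_top [simp]:
  "topspace (C_top r X V F) = {\<gamma>. C_on r X V F \<gamma> \<and> (\<forall>x. x \<notin> V \<longrightarrow> \<gamma> x = 0)}"
  by (simp add: C_top_def)

lemma chart_rep_in_C_top:
  "f \<in> C_maps r M F \<Longrightarrow> (U, \<kappa>) \<in> charts M \<Longrightarrow>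
    chart_rep (U, \<kappa>) f \<in> {\<gamma>. C_on r (model M) (\<kappa> ` U) F \<gamma> \<and> (\<forall>x. x \<notin> \<kappa> ` U \<longrightarrow> \<gamma> x = 0)}"
  using C_maps_chart[of f r M F U \<kappa>] by (simp add: chart_rep_def)

lemma continuous_map_C_space_iter_dq:
  assumes c: "(U, \<kappa>) \<in> charts M" and n: "enat n \<le> l"
  shows "continuous_map (topo (C_space l M F)) (compact_open (it_top (model M) (\<kappa> ` U) n) (topo F))
    (\<lambda>f. iter_dq (model M) (\<kappa> ` U) F (chart_rep (U, \<kappa>) f) n)"
proof -
  let ?T = "\<lambda>(U, \<kappa>). C_top l (model M) (\<kappa> ` U) F"
  have "continuous_map (topo (C_space l M F)) (?T (U, \<kappa>)) (chart_rep (U, \<kappa>))"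
    unfolding topo_C_space using chart_rep_in_C_top[OF _ c, of _ l F]
    by (intro continuous_map_initial_topology_proj c) simp
  then have 1: "continuous_map (topo (C_space l M F)) (C_top l (model M) (\<kappa> ` U) F) (chart_rep (U, \<kappa>))"
    by simp
  have 2: "continuous_map (C_top l (model M) (\<kappa> ` U) F)
      (compact_open (it_top (model M) (\<kappa> ` U) n) (topo F))
      (\<lambda>\<gamma>. iter_dq (model M) (\<kappa> ` U) F \<gamma> n)"
    unfolding C_top_def
  proof (rule continuous_map_initial_topology_proj)
    fix \<gamma> assume "\<gamma> \<in> {\<gamma>. C_on l (model M) (\<kappa> ` U) F \<gamma> \<and> (\<forall>x. x \<notin> \<kappa> ` U \<longrightarrow> \<gamma> x = 0)}"
    then have "C_fin (model M) (\<kappa> ` U) F n \<gamma>" using n by (simp add: C_on_def)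
    from C_fin_continuous[OF this order_refl]
    show "iter_dq (model M) (\<kappa> ` U) F \<gamma> n \<in> topspace (compact_open (it_top (model M) (\<kappa> ` U) n) (topo F))"
      by simp
  qed (simp add: n)
  show ?thesis using continuous_map_compose[OF 1 2] by (simp add: o_def)
qed

lemma continuous_map_into_C_space:
  assumes g: "\<And>z. z \<in> topspace Z \<Longrightarrow> g z \<in> C_maps l M F"
    and c: "\<And>U \<kappa> n. (U, \<kappa>) \<in> charts M \<Longrightarrow> enat n \<le> l \<Longrightarrow>
      continuous_map Z (compact_open (it_top (model M) (\<kappa> ` U) n) (topo F))
        (\<lambda>z. iter_dq (model M) (\<kappa> ` U) F (chart_rep (U, \<kappa>) (g z)) n)"
  shows "continuous_map Z (topo (C_space l M F)) g"
  unfolding topo_C_space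
proof (rule continuous_map_into_initial_topology[OF g])
  fix p assume p: "p \<in> charts M"
  obtain U \<kappa> where c': "p = (U, \<kappa>)" by (cases p)
  have "continuous_map Z (C_top l (model M) (\<kappa> ` U) F) (\<lambda>z. chart_rep (U, \<kappa>) (g z))"
    unfolding C_top_def
    using chart_rep_in_C_top[OF g] c p by (intro continuous_map_into_initial_topology) (auto simp: c')
  then show "continuous_map Z (case p of (U, \<kappa>) \<Rightarrow> C_top l (model M) (\<kappa> ` U) F) (\<lambda>z. chart_rep p (g z))"
    by (simp add: c')
qed

text \<open>The topology of \<open>C_space\<close> is initial in two layers, over charts and then
  over orders of difference quotients; compatibility of \<open>compact_open\<close> with initial
  topologies is applied once for each layer.\<close>

lemma continuous_map_into_compact_open_C_space:
  assumes S: "Hausdorff_space S"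
    and \<Phi>: "\<And>z s. z \<in> topspace Z \<Longrightarrow> s \<in> topspace S \<Longrightarrow> \<Phi> z s \<in> C_maps l M F"
    and c: "\<And>U \<kappa> n. (U, \<kappa>) \<in> charts M \<Longrightarrow> enat n \<le> l \<Longrightarrow>
      continuous_map Z (compact_open S (compact_open (it_top (model M) (\<kappa> ` U) n) (topo F)))
        (\<lambda>z s. iter_dq (model M) (\<kappa> ` U) F (chart_rep (U, \<kappa>) (\<Phi> z s)) n)"
  shows "continuous_map Z (compact_open S (topo (C_space l M F))) \<Phi>"
  unfolding topo_C_space
proof (rule continuous_map_compact_open_initial_topology[OF S \<Phi>])
  fix p assume p: "p \<in> charts M"
  obtain U \<kappa> where c': "p = (U, \<kappa>)" by (cases p)
  have "continuous_map Z (compact_open S (C_top l (model M) (\<kappa> ` U) F)) (\<lambda>z s. chart_rep (U, \<kappa>) (\<Phi> z s))"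
    unfolding C_top_def
  proof (rule continuous_map_compact_open_initial_topology[OF S])
    fix n assume "n \<in> {j. enat j \<le> l}"
    then show "continuous_map Z (compact_open S (compact_open (it_top (model M) (\<kappa> ` U) n) (topo F)))
        (\<lambda>z s. iter_dq (model M) (\<kappa> ` U) F (chart_rep (U, \<kappa>) (\<Phi> z s)) n)"
      using p by (intro c) (simp_all add: c')
  qed (rule chart_rep_in_C_top[OF \<Phi> p[unfolded c']])
  then show "continuous_map Z (compact_open S (case p of (U, \<kappa>) \<Rightarrow> C_top l (model M) (\<kappa> ` U) F))
      (\<lambda>z s. chart_rep p (\<Phi> z s))"
    by (simp add: c')
qed

text \<open>Point evaluations are continuous and separate maps. The result is required because
  \<open>C_space r N E\<close> is the target of the transposed map, and difference quotients are
  unique only in Hausdorff targets.\<close>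

lemma Hausdorff_C_space:
  assumes M: "manifold l M" and F: "tvs F"
  shows "Hausdorff_space (topo (C_space r M F))"
proof (rule Hausdorff_space_separating_maps[OF _ tvs_Hausdorff[OF F]])
  fix f g assume fg: "f \<in> topspace (topo (C_space r M F))" "g \<in> topspace (topo (C_space r M F))" "f \<noteq> g"
  then obtain x where x: "f x \<noteq> g x" by blast
  \<comment> \<open>Members of \<open>C_maps\<close> vanish off the manifold, so they can differ
    only at a point of it.\<close>
  have "x \<in> topspace (mtop M)"
    using x C_maps_outside[of f r M F x] C_maps_outside[of g r M F x] fg by force
  from manifold_chart_cover[OF M this] obtain U \<kappa> where c: "(U, \<kappa>) \<in> charts M" "x \<in> U" .
  note ch = manifold_is_chart[OF M c(1)]
  let ?S = "it_top (model M) (\<kappa> ` U) 0"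
  let ?\<Phi> = "\<lambda>f. iter_dq (model M) (\<kappa> ` U) F (chart_rep (U, \<kappa>) f) 0"
  have s: "Base (\<kappa> x) \<in> topspace ?S"
    using c(2) manifold_tvs[OF M] is_chart_openin_image[OF ch] by simp
  have "continuous_map (topo (C_space r M F)) (compact_open ?S (topo F)) ?\<Phi>"
    by (rule continuous_map_C_space_iter_dq[OF c(1)]) (simp add: zero_enat_def[symmetric])
  then have \<Phi>: "\<And>f. f \<in> C_maps r M F \<Longrightarrow> continuous_map ?S (topo F) (?\<Phi> f)"
    "\<And>K W. compactin ?S K \<Longrightarrow> openin (topo F) W \<Longrightarrow>
      openin (topo (C_space r M F)) {f \<in> C_maps r M F. ?\<Phi> f ` K \<subseteq> W}"
    unfolding continuous_map_compact_open_iff topspace_C_space by blast+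
  have "continuous_map (topo (C_space r M F)) (topo F) (\<lambda>f. ?\<Phi> f (Base (\<kappa> x)))"
    unfolding continuous_map_def
  proof (intro conjI allI impI)
    show "(\<lambda>f. ?\<Phi> f (Base (\<kappa> x))) \<in> topspace (topo (C_space r M F)) \<rightarrow> topspace (topo F)"
      using continuous_map_it_space_mem[OF \<Phi>(1) s] by auto
    fix W assume "openin (topo F) W"
    \<comment> \<open>A singleton is compact, so the compact-open topology controls the value at one
      point.\<close>
    from \<Phi>(2)[OF _ this, of "{Base (\<kappa> x)}"] s
    show "openin (topo (C_space r M F)) {f \<in> topspace (topo (C_space r M F)). ?\<Phi> f (Base (\<kappa> x)) \<in> W}"
      by simp
  qed
  then have "continuous_map (topo (C_space r M F)) (topo F) (\<lambda>f. f x)"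
    using c(2) by (simp add: chart_rep_apply[OF is_chart_inj_on[OF ch]])
  then show "\<exists>e. continuous_map (topo (C_space r M F)) (topo F) e \<and> e f \<noteq> e g"
    using x by (intro exI[of _ "\<lambda>f. f x"]) simp
qed


section \<open>The transposed map\<close>

text \<open>Precomposition with a fixed \<open>m\<close>, followed by currying. The function
  \<open>\<Phi> z\<close> varies with \<open>z\<close> and is never evaluated jointly in
  \<open>z\<close> and its argument.\<close>

lemma continuous_map_compact_open_precompose_uncurried:
  assumes A: "Hausdorff_space A"
    and \<Phi>: "continuous_map Z (compact_open S T) \<Phi>"
    and m: "continuous_map (prod_topology A B) S (\<lambda>(a, b). m a b)"
    and eq: "\<And>z a b. z \<in> topspace Z \<Longrightarrow> a \<in> topspace A \<Longrightarrow> b \<in> topspace B \<Longrightarrow> \<Psi> z a b = \<Phi> z (m a b)"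
  shows "continuous_map Z (compact_open A (compact_open B T)) \<Psi>"
proof (rule continuous_map_compact_open_compact_open[OF A])
  fix z assume z: "z \<in> topspace Z"
  then have "continuous_map S T (\<Phi> z)" using \<Phi> by (simp add: continuous_map_compact_open_iff)
  from continuous_map_compose[OF m this]
  show "continuous_map (prod_topology A B) T (\<lambda>(a, b). \<Psi> z a b)"
    by (rule continuous_map_eq) (auto simp: eq z)
next
  fix K Q W assume K: "compactin A K" and Q: "compactin B Q" and W: "openin T W"
  \<comment> \<open>The image of the compact rectangle under \<open>m\<close> is one compact subset
    of \<open>S\<close>, so the condition on \<open>\<Psi>\<close> becomes a single subbasic
    condition on \<open>\<Phi>\<close>.\<close>
  let ?L = "(\<lambda>(a, b). m a b) ` (K \<times> Q)"
  have "compactin (prod_topology A B) (K \<times> Q)" using K Q by (simp add: compactin_Times)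
  then have "compactin S ?L" by (rule image_compactin[OF _ m])
  then have "openin Z {z \<in> topspace Z. \<Phi> z ` ?L \<subseteq> W}"
    using \<Phi> W unfolding continuous_map_compact_open_iff by blast
  moreover have "\<Phi> z ` ?L \<subseteq> W \<longleftrightarrow> (\<forall>a\<in>K. \<forall>b\<in>Q. \<Psi> z a b \<in> W)" if z: "z \<in> topspace Z" for z
  proof -
    have "\<Psi> z a b = \<Phi> z (m a b)" if "a \<in> K" "b \<in> Q" for a b
      using eq[OF z] that compactin_subset_topspace[OF K] compactin_subset_topspace[OF Q] by blast
    then show ?thesis by (simp add: image_subset_iff)
  qed
  then have "{z \<in> topspace Z. \<Phi> z ` ?L \<subseteq> W} = {z \<in> topspace Z. \<forall>a\<in>K. \<forall>b\<in>Q. \<Psi> z a b \<in> W}"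
    by (intro Collect_cong) blast
  ultimately show "openin Z {z \<in> topspace Z. \<forall>a\<in>K. \<forall>b\<in>Q. \<Psi> z a b \<in> W}" by simp
qed

text \<open>The candidate for the \<open>j\<close>-th difference quotient of \<open>curry f\<close> in the chart \<open>c\<close>. Differentiating
  \<open>f(\<cdot>, y)\<close> for fixed \<open>y\<close> needs no chart of the second manifold.\<close>

definition curry_dq :: "('k::topological_field, 'm, 'v::ab_group_add) mfd \<Rightarrow> 'n topology
    \<Rightarrow> ('k, 'e::ab_group_add) tvs \<Rightarrow> ('m, 'v) chart \<Rightarrow> ('m \<times> 'n \<Rightarrow> 'e) \<Rightarrow> nat \<Rightarrow> ('v, 'k) itpoint \<Rightarrow> 'n \<Rightarrow> 'e"
  where
  "curry_dq M T E c f j u y =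
     (if y \<in> topspace T then iter_dq (model M) (snd c ` fst c) E (chart_rep c (\<lambda>x. f (x, y))) j u else 0)"

section \<open>The transposed map in charts of both manifolds\<close>

context
  fixes M :: "('k::topological_field, 'm, 'v::ab_group_add) mfd"
    and N :: "('k, 'n, 'w::ab_group_add) mfd"
    and E :: "('k, 'e::ab_group_add) tvs"
    and r k :: enat
  assumes M: "manifold (r + k) M" and N: "manifold (r + k) N" and E: "tvs E"
begin

abbreviation (input) "prod_model \<equiv> prod_tvs (model M) (model N)"
abbreviation (input) "prod_MN \<equiv> prod_mfd (r + k) M N"

lemma enat_add_le: "enat i \<le> r \<Longrightarrow> enat j \<le> k \<Longrightarrow> enat (i + j) \<le> r + k"
  by (metis add_mono plus_enat_simps(1))

lemma model_prod_mfd: "model prod_MN = prod_model" and mtop_prod_mfd: "mtop prod_MN = prod_topology (mtop M) (mtop N)"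
  by (simp_all add: prod_mfd_def)

context
  fixes U \<kappa> V \<mu>
  assumes c: "(U, \<kappa>) \<in> charts M" and d: "(V, \<mu>) \<in> charts N"
begin

abbreviation (input) "prod_rep f \<equiv> chart_rep (U \<times> V, map_prod \<kappa> \<mu>) f"
abbreviation (input) "prod_rep_dq f n \<equiv> iter_dq prod_model (\<kappa> ` U \<times> \<mu> ` V) E (prod_rep f) n"

lemmas chart_M = manifold_is_chart[OF M c] and chart_N = manifold_is_chart[OF N d]
lemmas chart_facts = manifold_tvs[OF M] manifold_tvs[OF N] E
  is_chart_openin_image[OF manifold_is_chart[OF M c]] is_chart_openin_image[OF manifold_is_chart[OF N d]]

lemma image_prod_chart: "map_prod \<kappa> \<mu> ` (U \<times> V) = \<kappa> ` U \<times> \<mu> ` V"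
  by (rule map_prod_surj_on) simp_all

lemma C_fin_rep:
  assumes "f \<in> C_maps (r + k) prod_MN E" "enat i \<le> r" "enat j \<le> k"
  shows "C_fin prod_model (\<kappa> ` U \<times> \<mu> ` V) E (i + j) (prod_rep f)"
  using C_maps_chart[OF assms(1) prod_chart_in_charts[OF M N c d]] enat_add_le[OF assms(2,3)]
  by (simp add: C_on_def model_prod_mfd image_prod_chart)

text \<open>Two stages: over a chart of \<open>N\<close>, fixing the second variable identifies the
  candidate with \<open>z \<mapsto> prod_rep_dq f j (graft_point u z)\<close>, and fixing the tree
  \<open>u\<close> then yields its quotients in \<open>z\<close>. Regularity of \<open>f\<close> is
  spent as \<open>j\<close> orders plus \<open>i\<close> orders.\<close>

lemma chart_rep_curry_dq:
  assumes f: "f \<in> C_maps (r + k) prod_MN E" and i: "enat i \<le> r" and j: "enat j \<le> k"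
    and u: "u \<in> it_set (model M) (\<kappa> ` U) j"
  shows "C_fin (model N) (\<mu> ` V) E i (chart_rep (V, \<mu>) (curry_dq M (mtop N) E (U, \<kappa>) f j u))"
    and "w \<in> it_set (model N) (\<mu> ` V) i \<Longrightarrow>
      iter_dq (model N) (\<mu> ` V) E (chart_rep (V, \<mu>) (curry_dq M (mtop N) E (U, \<kappa>) f j u)) i w =
      prod_rep_dq f (i + j) (graft w j u)"
proof -
  \<comment> \<open>The first stage takes quotients in the first variable only, so
    \<open>C_fin_rep\<close> is used there at order \<open>0 + j\<close>.\<close>
  have i0: "enat 0 \<le> r" by (simp add: zero_enat_def[symmetric])
  let ?g = "\<lambda>z. prod_rep_dq f j (graft_point u z)"
  have eq: "chart_rep (V, \<mu>) (curry_dq M (mtop N) E (U, \<kappa>) f j u) z = ?g z" if z: "z \<in> \<mu> ` V" for z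
  proof -
    obtain y where y: "y \<in> V" "z = \<mu> y" using z by blast
    have inv: "the_inv_into V \<mu> z = y" using y is_chart_inj_on[OF chart_N] by (simp add: the_inv_into_f_f)
    have yN: "y \<in> topspace (mtop N)" using y(1) openin_subset[OF is_chart_openin_dom[OF chart_N]] by blast
    have "chart_rep (V, \<mu>) (curry_dq M (mtop N) E (U, \<kappa>) f j u) z = curry_dq M (mtop N) E (U, \<kappa>) f j u y"
      using y by (simp add: chart_rep_apply[OF is_chart_inj_on[OF chart_N]])
    also have "\<dots> = iter_dq (model M) (\<kappa> ` U) E (chart_rep (U, \<kappa>) (\<lambda>x. f (x, y))) j u"
      using yN by (simp add: curry_dq_def)
    also have "chart_rep (U, \<kappa>) (\<lambda>x. f (x, y)) = (\<lambda>x. prod_rep f (x, z))"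
      by (rule ext, subst chart_rep_prod_apply[OF is_chart_inj_on[OF chart_M] is_chart_inj_on[OF chart_N] z])
        (simp add: inv)
    also have "iter_dq (model M) (\<kappa> ` U) E (\<lambda>x. prod_rep f (x, z)) j u = ?g z"
      using C_fin_fixed_snd[OF chart_facts C_fin_rep[OF f i0 j] z] u by simp
    finally show ?thesis .
  qed
  have C: "C_fin (model N) (\<mu> ` V) E i ?g"
    and dq: "\<And>w. w \<in> it_set (model N) (\<mu> ` V) i \<Longrightarrow> iter_dq (model N) (\<mu> ` V) E ?g i w = prod_rep_dq f (i + j) (graft w j u)"
    using C_fin_fixed_fst[OF chart_facts C_fin_rep[OF f i j] u] by blast+
  from C_fin_cong[OF chart_facts(2,5) tvs_Hausdorff[OF E] C eq]
  show "C_fin (model N) (\<mu> ` V) E i (chart_rep (V, \<mu>) (curry_dq M (mtop N) E (U, \<kappa>) f j u))"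
    and "w \<in> it_set (model N) (\<mu> ` V) i \<Longrightarrow>
      iter_dq (model N) (\<mu> ` V) E (chart_rep (V, \<mu>) (curry_dq M (mtop N) E (U, \<kappa>) f j u)) i w =
      prod_rep_dq f (i + j) (graft w j u)"
    by (simp_all add: dq del: iter_dq.simps)
qed

lemma rep_dq_graft:
  "continuous_map (prod_topology (it_top (model M) (\<kappa> ` U) j) (it_top (model N) (\<mu> ` V) i))
    (it_top prod_model (\<kappa> ` U \<times> \<mu> ` V) (i + j)) (\<lambda>(u, w). graft w j u)"
  by (rule graft_it_top[OF chart_facts])

end

context
  fixes U \<kappa>
  assumes c: "(U, \<kappa>) \<in> charts M"
begin

abbreviation (input) "chart_dq f j \<equiv> curry_dq M (mtop N) E (U, \<kappa>) f j"

lemma openin_chart_M: "openin (topo (model M)) (\<kappa> ` U)"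
  by (rule is_chart_openin_image[OF manifold_is_chart[OF M c]])

lemma curry_dq_in_C_maps:
  assumes "f \<in> C_maps (r + k) prod_MN E" "enat j \<le> k" "u \<in> it_set (model M) (\<kappa> ` U) j"
  shows "chart_dq f j u \<in> C_maps r N E"
proof (rule C_mapsI[OF N])
  fix V \<mu> assume "(V, \<mu>) \<in> charts N"
  then show "C_on r (model N) (\<mu> ` V) E (chart_rep (V, \<mu>) (chart_dq f j u))"
    unfolding C_on_def using chart_rep_curry_dq(1)[OF c _ assms(1) _ assms(2,3)] by blast
qed (simp add: curry_dq_def)

text \<open>With \<open>f\<close> fixed, its quotient of order \<open>i + j\<close> composed with
  \<open>graft\<close> is jointly continuous in \<open>u\<close> and \<open>w\<close>, so currying
  gives continuity into each compact-open topology that defines the target.\<close>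

lemma continuous_map_curry_dq:
  assumes f: "f \<in> C_maps (r + k) prod_MN E" and j: "enat j \<le> k"
  shows "continuous_map (it_top (model M) (\<kappa> ` U) j) (topo (C_space r N E)) (chart_dq f j)"
proof (rule continuous_map_into_C_space)
  note top = topspace_it_top[OF manifold_tvs[OF M] openin_chart_M]
  show "chart_dq f j u \<in> C_maps r N E" if "u \<in> topspace (it_top (model M) (\<kappa> ` U) j)" for u
    using curry_dq_in_C_maps[OF f j] that by (simp add: top)
  fix V \<mu> i assume d: "(V, \<mu>) \<in> charts N" and i: "enat i \<le> r"
  have "continuous_map (it_top (model M) (\<kappa> ` U) j) (compact_open (it_top (model N) (\<mu> ` V) i) (topo E))
      (\<lambda>u w. prod_rep_dq U \<kappa> V \<mu> f (i + j) (graft w j u))"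
    using continuous_map_compose[OF rep_dq_graft[OF c d] C_fin_continuous[OF C_fin_rep[OF c d f i j] order_refl]]
    by (intro continuous_map_compact_open_uncurried) (simp add: o_def case_prod_unfold)
  then show "continuous_map (it_top (model M) (\<kappa> ` U) j) (compact_open (it_top (model N) (\<mu> ` V) i) (topo E))
      (\<lambda>u. iter_dq (model N) (\<mu> ` V) E (chart_rep (V, \<mu>) (chart_dq f j u)) i)"
    by (rule continuous_map_compact_open_cong)
      (simp add: top chart_rep_curry_dq(2)[OF c d f i j] it_top_mem del: iter_dq.simps)
qed

text \<open>Subtraction and scalar multiplication in \<open>C_space r N E\<close> are pointwise, so
  the quotient relation may be checked at each \<open>y\<close> separately, where it is the relation
  for the partial map of \<open>f\<close> at \<open>y\<close>. The analytic content is the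
  continuity of the candidates.\<close>

lemma C_fin_curry:
  assumes f: "f \<in> C_maps (r + k) prod_MN E" and n: "enat n \<le> k"
  shows "C_fin (model M) (\<kappa> ` U) (C_space r N E) n (chart_rep (U, \<kappa>) (curry f)) \<and>
    (\<forall>j\<le>n. \<forall>u\<in>it_set (model M) (\<kappa> ` U) j.
      iter_dq (model M) (\<kappa> ` U) (C_space r N E) (chart_rep (U, \<kappa>) (curry f)) j u = chart_dq f j u)"
proof (rule C_finI_dq[OF manifold_tvs[OF M] openin_chart_M Hausdorff_C_space[OF N E]])
  have n': "enat j \<le> k" if "j \<le> n" for j using n that by (meson enat_ord_simps(1) order_trans)
  show "chart_dq f 0 (Base x) = chart_rep (U, \<kappa>) (curry f) x" if "x \<in> \<kappa> ` U" for x
  proof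
    fix y
    \<comment> \<open>For \<open>y\<close> outside \<open>N\<close> the candidate is
      \<open>0\<close> by definition, and \<open>f\<close> vanishes there because maps on a manifold
      are extended by zero.\<close>
    show "chart_dq f 0 (Base x) y = chart_rep (U, \<kappa>) (curry f) x y"
      using that C_maps_outside[OF f, of "(the_inv_into U \<kappa> x, y)"]
      by (simp add: curry_dq_def chart_rep_def mtop_prod_mfd)
  qed
  show "continuous_map (it_top (model M) (\<kappa> ` U) j) (topo (C_space r N E)) (chart_dq f j)" if "j \<le> n" for j
    by (rule continuous_map_curry_dq[OF f n'[OF that]])
  fix j u u' t assume j: "j < n" and u: "Ext u u' t \<in> it_set (model M) (\<kappa> ` U) (Suc j)" and t: "t \<noteq> (0 :: 'k)"
  show "chart_dq f (Suc j) (Ext u u' t) =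
    scl (C_space r N E) (1 / t) (chart_dq f j (shift (model M) u t u') - chart_dq f j u)"
  proof
    fix y
    show "chart_dq f (Suc j) (Ext u u' t) y =
      scl (C_space r N E) (1 / t) (chart_dq f j (shift (model M) u t u') - chart_dq f j u) y"
    proof (cases "y \<in> topspace (mtop N)")
      case True
      \<comment> \<open>The regularity of \<open>f\<close> is expressed in product charts, so a
        chart of \<open>N\<close> around \<open>y\<close> is needed to obtain that of the partial
        map, although the partial map itself does not depend on it.\<close>
      from manifold_chart_cover[OF N True] obtain V \<mu> where d: "(V, \<mu>) \<in> charts N" "y \<in> V" .
      note inj = is_chart_inj_on[OF manifold_is_chart[OF M c]] is_chart_inj_on[OF manifold_is_chart[OF N d(1)]]
      have i0: "enat 0 \<le> r" by (simp add: zero_enat_def[symmetric])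
      have z: "\<mu> y \<in> \<mu> ` V" using d(2) by simp
      have eq: "(\<lambda>x. prod_rep U \<kappa> V \<mu> f (x, \<mu> y)) = chart_rep (U, \<kappa>) (\<lambda>x. f (x, y))"
        by (rule ext, subst chart_rep_prod_apply[OF inj z]) (simp add: the_inv_into_f_f[OF inj(2) d(2)])
      have "C_fin (model M) (\<kappa> ` U) E n (chart_rep (U, \<kappa>) (\<lambda>x. f (x, y)))"
        using C_fin_fixed_snd[OF chart_facts[OF c d(1)] C_fin_rep[OF c d(1) f i0 n] z] unfolding eq by simp
      from iter_dq_Ext[OF this j u t] True show ?thesis
        by (simp add: curry_dq_def scl_C_space del: iter_dq.simps)
    next
      case False
      then show ?thesis by (simp add: curry_dq_def scl_C_space tvs_scl_zero_right[OF E])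
    qed
  qed
qed

end

lemma curry_in_C_maps:
  assumes f: "f \<in> C_maps (r + k) prod_MN E"
  shows "curry f \<in> C_maps k M (C_space r N E)"
proof (rule C_mapsI[OF M])
  fix U \<kappa> assume "(U, \<kappa>) \<in> charts M"
  then show "C_on k (model M) (\<kappa> ` U) (C_space r N E) (chart_rep (U, \<kappa>) (curry f))"
    unfolding C_on_def using C_fin_curry[OF _ f] by blast
next
  fix x assume "x \<notin> topspace (mtop M)"
  then show "curry f x = 0"
    using C_maps_outside[OF f] by (auto simp: fun_eq_iff mtop_prod_mfd)
qed

text \<open>The outer topology is tested through the quotients of the transposed map, which are
  first replaced by the candidates. Each remaining test is a quotient of \<open>f\<close> over a
  product chart, precomposed with \<open>graft\<close>, and depends continuously on \<open>f\<close>
  by definition of the topology on the product manifold.\<close>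

lemma continuous_map_curry:
  "continuous_map (topo (C_space (r + k) prod_MN E)) (topo (C_space k M (C_space r N E))) curry"
proof (rule continuous_map_into_C_space)
  show "curry f \<in> C_maps k M (C_space r N E)" if "f \<in> topspace (topo (C_space (r + k) prod_MN E))" for f
    using that by (intro curry_in_C_maps) simp
  fix U \<kappa> j assume c: "(U, \<kappa>) \<in> charts M" and j: "enat j \<le> k"
  let ?S = "it_top (model M) (\<kappa> ` U) j"
  have S: "Hausdorff_space ?S" by (intro Hausdorff_it_top tvs_Hausdorff manifold_tvs[OF M])
  note top = topspace_it_top[OF manifold_tvs[OF M] openin_chart_M[OF c]]
  have "continuous_map (topo (C_space (r + k) prod_MN E)) (compact_open ?S (topo (C_space r N E)))
      (\<lambda>f. curry_dq M (mtop N) E (U, \<kappa>) f j)"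
  proof (rule continuous_map_into_compact_open_C_space[OF S])
    show "curry_dq M (mtop N) E (U, \<kappa>) f j u \<in> C_maps r N E"
      if "f \<in> topspace (topo (C_space (r + k) prod_MN E))" "u \<in> topspace ?S" for f u
      using that by (intro curry_dq_in_C_maps[OF c _ j]) (simp_all add: top)
    fix V \<mu> i assume d: "(V, \<mu>) \<in> charts N" and i: "enat i \<le> r"
    have "continuous_map (topo (C_space (r + k) prod_MN E))
        (compact_open (it_top prod_model (\<kappa> ` U \<times> \<mu> ` V) (i + j)) (topo E)) (\<lambda>f. prod_rep_dq U \<kappa> V \<mu> f (i + j))"
      using continuous_map_C_space_iter_dq[OF prod_chart_in_charts[OF M N c d] enat_add_le[OF i j]]
      by (simp add: model_prod_mfd image_prod_chart[OF c d])
    then show "continuous_map (topo (C_space (r + k) prod_MN E))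
        (compact_open ?S (compact_open (it_top (model N) (\<mu> ` V) i) (topo E)))
        (\<lambda>f u. iter_dq (model N) (\<mu> ` V) E (chart_rep (V, \<mu>) (curry_dq M (mtop N) E (U, \<kappa>) f j u)) i)"
      by (rule continuous_map_compact_open_precompose_uncurried[OF S _ rep_dq_graft[OF c d]])
        (simp add: it_top_mem chart_rep_curry_dq(2)[OF c d _ i j] del: iter_dq.simps)
  qed
  then show "continuous_map (topo (C_space (r + k) prod_MN E)) (compact_open ?S (topo (C_space r N E)))
      (\<lambda>f. iter_dq (model M) (\<kappa> ` U) (C_space r N E) (chart_rep (U, \<kappa>) (curry f)) j)"
    by (rule continuous_map_compact_open_cong) (use C_fin_curry[OF c _ j] in \<open>simp add: top del: iter_dq.simps\<close>)
qed

end

theorem lemma12p1: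
  fixes M :: "('k::topological_field, 'm, 'v::ab_group_add) mfd"
    and N :: "('k, 'n, 'w::ab_group_add) mfd"
    and E :: "('k, 'e::ab_group_add) tvs"
    and r k :: enat
  assumes "manifold (r + k) M" and "manifold (r + k) N" and "tvs E"
  shows "(\<forall>f \<in> C_maps (r + k) (prod_mfd (r + k) M N) E. curry f \<in> C_maps k M (C_space r N E)) \<and>
         Vector_Spaces.linear
           (scl (C_space (r + k) (prod_mfd (r + k) M N) E)) (scl (C_space k M (C_space r N E)))
           (curry :: ('m \<times> 'n \<Rightarrow> 'e) \<Rightarrow> 'm \<Rightarrow> 'n \<Rightarrow> 'e) \<and>
         continuous_map
           (topo (C_space (r + k) (prod_mfd (r + k) M N) E)) (topo (C_space k M (C_space r N E)))
           curry"
proof (intro conjI ballI)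
  show "curry f \<in> C_maps k M (C_space r N E)" if "f \<in> C_maps (r + k) (prod_mfd (r + k) M N) E" for f
    by (rule curry_in_C_maps[OF assms that])
  show "Vector_Spaces.linear
      (scl (C_space (r + k) (prod_mfd (r + k) M N) E)) (scl (C_space k M (C_space r N E)))
      (curry :: ('m \<times> 'n \<Rightarrow> 'e) \<Rightarrow> 'm \<Rightarrow> 'n \<Rightarrow> 'e)"
    \<comment> \<open>\<open>Vector_Spaces.linear\<close> demands the vector space laws on the full
      function types. They hold pointwise, since \<open>tvs\<close> makes \<open>scl E\<close> a
      vector space structure on the entire ambient type of \<open>E\<close>.\<close>
    by unfold_locales (auto simp: fun_eq_iff scl_C_space tvs_scl[OF assms(3)])
qed (rule continuous_map_curry[OF assms])

end
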